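(* Let $H\in(1/2,1]$, $\sigma>0$, and let $\{B_H(t)\}_{t\in\mathbb{R}}$ be a fractional Brownian motion with Hurst parameter $H$. Let $q\ge 1$, let $\lambda_1,\dots,\lambda_q$ be pairwise different positive real numbers, let $p_1,\dots,p_q$ be positive integers, and suppose $p:=p_1+\cdots+p_q\ge 2$. Let $$X_t:=\Big(\prod_{i=1}^{q}T_{\lambda_i}^{p_i}\Big)(\sigma B_H)(t),\qquad t\in\mathbb{R}.$$ Then $$\sum_{n=-\infty}^{+\infty}\left|\mathbb{E}(X_0X_n)\right|<+\infty,$$ i.e. $\{X_t\}_{t\in\mathbb{R}}$ is a short memory process.
   Context: A fractional Brownian motion with Hurst parameter $H\in(0,1]$ is an almost surely continuous centered Gaussian process $\{B_H(t)\}_{t\in\mathbb{R}}$ with $\mathbb{E}(B_H(t)B_H(s))=\frac12(|t|^{2H}+|s|^{2H}-|t-s|^{2H})$ for $t,s\in\mathbb{R}$. For $\lambda>0$ and a continuous process $y=\{y(t)\}_{t\in\mathbb{R}}$ for which the integral exists, the operator $T_\lambda$ is defined by $T_\lambda(y)(t)=\int_{-\infty}^{t}e^{-\lambda(t-s)}\,dy(s)$ (pathwise improper Riemann–Stieltjes integral). $\prod_{i=1}^{q}T_{\lambda_i}^{p_i}$ denotes composition of operators: $T_{\lambda_i}$ is applied $p_i$ times for each $i$; these operators commute, so the order is irrelevant. A stationary centered process is called long memory if $\sum_{n\in\mathbb{Z}}|\mathbb{E}(X_0X_n)|=+\infty$, and short memory if this sum is finite. *)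

theory Defs
  imports "HOL-Probability.Probability"
begin

text \<open>
  Riemann--Stieltjes integral of \<open>f\<close> against \<open>g\<close> over \<open>[a, b]\<close>, as the limit of tagged sums
  when the mesh tends to 0. The integrator need not have bounded variation.
\<close>
definition has_RS_integral ::
    "(real \<Rightarrow> real) \<Rightarrow> (real \<Rightarrow> real) \<Rightarrow> real \<Rightarrow> real \<Rightarrow> real \<Rightarrow> bool" where
  "has_RS_integral f g I a b \<longleftrightarrow>
     (\<forall>\<epsilon>>0. \<exists>\<delta>>0. \<forall>(n::nat) (x :: nat \<Rightarrow> real) (\<xi> :: nat \<Rightarrow> real).
        x 0 = a \<and> x n = b \<and>
        (\<forall>i<n. x i \<le> \<xi> i \<and> \<xi> i \<le> x (Suc i) \<and> x (Suc i) - x i < \<delta>) \<longrightarrow>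
        \<bar>(\<Sum>i<n. f (\<xi> i) * (g (x (Suc i)) - g (x i))) - I\<bar> < \<epsilon>)"

definition has_RS_integral_at_bot ::
    "(real \<Rightarrow> real) \<Rightarrow> (real \<Rightarrow> real) \<Rightarrow> real \<Rightarrow> real \<Rightarrow> bool" where
  "has_RS_integral_at_bot f g I t \<longleftrightarrow>
     (\<exists>J. (\<forall>a\<le>t. has_RS_integral f g (J a) a t) \<and> (J \<longlongrightarrow> I) at_bot)"

text \<open>
  The operator acts on one path; its value is unspecified where the improper integral
  does not exist.
\<close>
definition OU_op :: "real \<Rightarrow> (real \<Rightarrow> real) \<Rightarrow> real \<Rightarrow> real" where
  "OU_op l y t = (THE I. has_RS_integral_at_bot (\<lambda>s. exp (- l * (t - s))) y I t)"

text \<open>The composition \<open>T\<^bsub>l 1\<^esub>\<^bsup>p 1\<^esup> \<circ> \<dots> \<circ> T\<^bsub>l q\<^esub>\<^bsup>p q\<^esup>\<close>.\<close>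
definition OU_prod ::
    "nat \<Rightarrow> (nat \<Rightarrow> real) \<Rightarrow> (nat \<Rightarrow> nat) \<Rightarrow> (real \<Rightarrow> real) \<Rightarrow> real \<Rightarrow> real" where
  "OU_prod q l p y = foldr (\<lambda>i. OU_op (l i) ^^ p i) [1..<Suc q] y"

text \<open>Point masses count as Gaussian laws (the case \<open>s = 0\<close>).\<close>
definition gaussian_rv :: "'a measure \<Rightarrow> ('a \<Rightarrow> real) \<Rightarrow> bool" where
  "gaussian_rv M Y \<longleftrightarrow> Y \<in> borel_measurable M \<and>
     (\<exists>m s. s \<ge> 0 \<and>
        (if s = 0 then AE w in M. Y w = m
         else distributed M lborel Y (\<lambda>x. ennreal (normal_density m s x))))"

definition gaussian_process :: "'a measure \<Rightarrow> (real \<Rightarrow> 'a \<Rightarrow> real) \<Rightarrow> bool" where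
  "gaussian_process M B \<longleftrightarrow>
     (\<forall>(J :: real set) c. finite J \<longrightarrow> gaussian_rv M (\<lambda>w. \<Sum>t\<in>J. c t * B t w))"

definition fractional_brownian_motion ::
    "'a measure \<Rightarrow> real \<Rightarrow> (real \<Rightarrow> 'a \<Rightarrow> real) \<Rightarrow> bool" where
  "fractional_brownian_motion M H B \<longleftrightarrow>
     0 < H \<and> H \<le> 1 \<and>
     (AE w in M. continuous_on UNIV (\<lambda>t. B t w)) \<and>
     gaussian_process M B \<and>
     (\<forall>t. (\<integral>w. B t w \<partial>M) = 0) \<and>
     (\<forall>t s. (\<integral>w. B t w * B s w \<partial>M) =
        (1/2) * (\<bar>t\<bar> powr (2 * H) + \<bar>s\<bar> powr (2 * H) - \<bar>t - s\<bar> powr (2 * H)))"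

text \<open>
  A process built pathwise from an almost surely continuous one is determined only almost surely.
  On the exceptional null set it need not be measurable with respect to the original
  sigma-algebra, so its moments are to be taken in the completion
  of the probability space.

  Stationarity is meant in the second-order sense, the one relevant to covariances; for Gaussian
  processes it is equivalent to invariance of the finite-dimensional laws under time shifts.
\<close>
definition stationary_centered :: "'a measure \<Rightarrow> (real \<Rightarrow> 'a \<Rightarrow> real) \<Rightarrow> bool" where
  "stationary_centered M X \<longleftrightarrow>
     (\<forall>t. X t \<in> borel_measurable M \<and> integrable M (\<lambda>w. (X t w)\<^sup>2)) \<and>
     (\<forall>t. (\<integral>w. X t w \<partial>M) = 0) \<and>
     (\<forall>s t h. (\<integral>w. X (s + h) w * X (t + h) w \<partial>M) = (\<integral>w. X s w * X t w \<partial>M))"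

definition short_memory :: "'a measure \<Rightarrow> (real \<Rightarrow> 'a \<Rightarrow> real) \<Rightarrow> bool" where
  "short_memory M X \<longleftrightarrow> stationary_centered M X \<and>
     (\<lambda>n::int. \<bar>\<integral>w. X 0 w * X (of_int n) w \<partial>M\<bar>) summable_on UNIV"

end

theory Submission
  imports Defs "HOL-Real_Asymp.Real_Asymp"
begin

text \<open>
  On a continuous path of at most quadratic growth the operator with parameter \<open>\<lambda>\<close> averages the increment
  \<open>y(t) - y(t - U)\<close> over an exponential variable \<open>U\<close> of rate \<open>\<lambda>\<close>. By Fubini it acts on a covariance
  \<open>g(s - t)\<close> by averaging the mixed second difference
  \<open>g(h) - g(h - u) - g(h + v) + g(h - u + v)\<close> over two independent such variables, and the
  terms of the covariance of fractional Brownian motion that depend on one time only cancel. Two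
  applications therefore turn \<open>\<bar>h\<bar>\<^bsup>2H\<^esup>\<close> into an average of fourth differences; by the mean value theorem
  these are \<open>O(h\<^bsup>2H-4\<^esup>)\<close>, hence \<open>O(1/(1 + h\<^sup>2))\<close>, with constants polynomial in the step sizes. Further
  applications preserve this summable bound. Since \<open>2H > 1\<close>, dyadic chaining with
  second moments gives the quadratic growth of almost every path.
\<close>

section \<open>The operator on a single path\<close>

text \<open>The threshold of two applications comes from the covariance. One differencing in each
  time leaves a tail of order \<open>h^(2H-2)\<close>, which is not summable because
  \<open>2H > 1\<close>; a second one leaves \<open>h^(2H-4)\<close>, and
  \<open>2H - 4 \<le> -2\<close>. The cancellation has to survive both applications, so absolute
  values are taken only once the fourth difference has formed under the averages. The mean value
  theorem is available only while all nodes stay away from the singularity of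
  \<open>\<bar>x\<bar> powr (2 * H)\<close> at 0. Otherwise the steps themselves dominate
  \<open>h\<close>, and a trivial bound with a polynomial weight in the steps suffices, since
  exponential variables have all moments. The other obstacle is that the operator is defined path by
  path through \<open>THE\<close>, and only almost every path is good. Bad paths are replaced by
  zero on a null set, the analysis is done for processes all of whose paths are good, and the
  moments are carried back in the completion.\<close>

definition expm :: "real \<Rightarrow> real measure" where
  "expm l = density lborel (exponential_density l)"

lemma space_expm [simp]: "space (expm l) = UNIV"
  and sets_expm [measurable_cong, simp]: "sets (expm l) = sets borel"
  by (simp_all add: expm_def)

lemma prob_space_expm: "0 < l \<Longrightarrow> prob_space (expm l)"
  unfolding expm_def by (rule prob_space_exponential_density)

lemma AE_expm_nonneg: "AE u in expm l. 0 \<le> u"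
  unfolding expm_def by (subst AE_density) (auto simp: exponential_density_def)

lemma integrable_expm_power:
  assumes l: "0 < l"
  shows "integrable (expm l) (\<lambda>u. (1 + \<bar>u\<bar>) ^ k)"
proof -
  interpret prob_space "expm l" by (rule prob_space_expm[OF l])
  have "distributed (expm l) lborel (\<lambda>x. x) (exponential_density l)"
    by (auto simp: distributed_def expm_def distr_id2 cong: distr_cong)
  then have "integrable (expm l) (\<lambda>u. u ^ i)" for i
    using erlang_ith_moment_integrable[OF l, of "\<lambda>x. x" 0 i] by simp
  then have "integrable (expm l) (\<lambda>u. \<Sum>i\<le>k. of_nat (k choose i) * u ^ i * 1 ^ (k - i))"
    by (intro Bochner_Integration.integrable_sum) simp
  then have "integrable (expm l) (\<lambda>u. (u + 1) ^ k)"
    by (subst binomial_ring)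
  moreover have "AE u in expm l. (u + 1) ^ k = (1 + \<bar>u\<bar>) ^ k"
    using AE_expm_nonneg[of l] by eventually_elim (simp add: add.commute)
  ultimately show ?thesis
    by (subst integrable_cong_AE[symmetric]) auto
qed

text \<open>Submultiplicativity of the weight \<open>1 + \<bar>x\<bar>\<close> splits a bound at a
  shifted time into one factor per variable, which is the form that averages over independent steps
  can integrate.\<close>

lemma one_plus_abs_add_le: "1 + \<bar>x + y\<bar> \<le> (1 + \<bar>x\<bar>) * (1 + \<bar>y::real\<bar>)"
proof -
  have "(1 + \<bar>x\<bar>) * (1 + \<bar>y\<bar>) = 1 + \<bar>x\<bar> + \<bar>y\<bar> + \<bar>x\<bar> * \<bar>y\<bar>" by (simp add: algebra_simps)
  moreover have "0 \<le> \<bar>x\<bar> * \<bar>y\<bar>" by simp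
  ultimately show ?thesis using abs_triangle_ineq[of x y] by linarith
qed

lemma one_plus_abs_add_power_le:
  "(1 + \<bar>x + y\<bar>) ^ k \<le> (1 + \<bar>x\<bar>) ^ k * (1 + \<bar>y::real\<bar>) ^ k"
  using power_mono[OF one_plus_abs_add_le, of x y k] by (simp add: power_mult_distrib)

lemma one_plus_abs_diff_power_le:
  "(1 + \<bar>x - y\<bar>) ^ k \<le> (1 + \<bar>x\<bar>) ^ k * (1 + \<bar>y::real\<bar>) ^ k"
  using one_plus_abs_add_power_le[of x "- y" k] by simp

text \<open>The exponent 2 is what chaining over unit intervals yields for paths, and it also admits
  the covariance functions \<open>c * \<bar>x\<bar> powr p\<close> with
  \<open>p \<le> 2\<close>.\<close>

definition tame :: "(real \<Rightarrow> real) \<Rightarrow> bool" where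
  "tame y \<longleftrightarrow> continuous_on UNIV y \<and> (\<exists>C. \<forall>t. \<bar>y t\<bar> \<le> C * (1 + \<bar>t\<bar>) ^ 2)"

lemma tameE:
  assumes "tame y"
  obtains C where "0 \<le> C" "continuous_on UNIV y" "\<And>t. \<bar>y t\<bar> \<le> C * (1 + \<bar>t\<bar>) ^ 2"
proof -
  obtain C where C: "\<And>t. \<bar>y t\<bar> \<le> C * (1 + \<bar>t\<bar>) ^ 2" and "continuous_on UNIV y"
    using assms unfolding tame_def by auto
  moreover have "0 \<le> C" using C[of 0] by (simp add: abs_le_iff)
  ultimately show thesis using that by blast
qed

lemma tame_measurable [measurable_dest]: "tame y \<Longrightarrow> y \<in> borel_measurable borel"
  unfolding tame_def by (auto intro: borel_measurable_continuous_onI)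

lemma tame_shift_le:
  assumes C: "\<And>t. \<bar>y t\<bar> \<le> C * (1 + \<bar>t::real\<bar>) ^ 2" and "0 \<le> C"
  shows "\<bar>y (t - u)\<bar> \<le> C * (1 + \<bar>t\<bar>) ^ 2 * (1 + \<bar>u\<bar>) ^ 2"
  using order_trans[OF C[of "t - u"] mult_left_mono[OF one_plus_abs_diff_power_le \<open>0 \<le> C\<close>]]
  by (simp add: mult.assoc)

lemma tame_integrable_shift:
  assumes y: "tame y" and l: "0 < l"
  shows "integrable (expm l) (\<lambda>u. y (t - u))"
    and "integrable (expm l) (\<lambda>u. (y (t - u))\<^sup>2)"
proof -
  note [measurable] = tame_measurable[OF y]
  obtain C where C: "0 \<le> C" "\<And>t. \<bar>y t\<bar> \<le> C * (1 + \<bar>t\<bar>) ^ 2" using tameE[OF y] by metis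
  note le = tame_shift_le[OF C(2,1)]
  show "integrable (expm l) (\<lambda>u. y (t - u))"
  proof (rule Bochner_Integration.integrable_bound)
    show "integrable (expm l) (\<lambda>u. C * (1 + \<bar>t\<bar>) ^ 2 * (1 + \<bar>u\<bar>) ^ 2)"
      using integrable_expm_power[OF l] by simp
    show "AE u in expm l. norm (y (t - u)) \<le> norm (C * (1 + \<bar>t\<bar>) ^ 2 * (1 + \<bar>u\<bar>) ^ 2)"
      using le by (intro always_eventually allI) (simp add: order_trans[OF _ abs_ge_self])
  qed simp
  show "integrable (expm l) (\<lambda>u. (y (t - u))\<^sup>2)"
  proof (rule Bochner_Integration.integrable_bound)
    show "integrable (expm l) (\<lambda>u. (C * (1 + \<bar>t\<bar>) ^ 2)\<^sup>2 * (1 + \<bar>u\<bar>) ^ 4)"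
      using integrable_expm_power[OF l] by simp
    show "AE u in expm l. norm ((y (t - u))\<^sup>2) \<le> norm ((C * (1 + \<bar>t\<bar>) ^ 2)\<^sup>2 * (1 + \<bar>u\<bar>) ^ 4)"
    proof (intro always_eventually allI)
      fix u
      have "(y (t - u))\<^sup>2 \<le> (C * (1 + \<bar>t\<bar>) ^ 2 * (1 + \<bar>u\<bar>) ^ 2)\<^sup>2"
        using le[of t u] by (intro abs_le_square_iff[THEN iffD1]) simp
      also have "\<dots> = (C * (1 + \<bar>t\<bar>) ^ 2)\<^sup>2 * (1 + \<bar>u\<bar>) ^ 4"
        by (simp add: power_mult_distrib flip: power_mult)
      finally show "norm ((y (t - u))\<^sup>2) \<le> norm ((C * (1 + \<bar>t\<bar>) ^ 2)\<^sup>2 * (1 + \<bar>u\<bar>) ^ 4)"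
        by simp
    qed
  qed simp
qed

text \<open>Integrating by parts, \<open>T\<^sub>\<lambda>(y)(t) = E (y(t) - y(t - U))\<close> with \<open>U\<close> exponential of rate \<open>\<lambda>\<close>.\<close>
definition exp_diff :: "real \<Rightarrow> (real \<Rightarrow> real) \<Rightarrow> real \<Rightarrow> real" where
  "exp_diff l y t = (\<integral>u. y t - y (t - u) \<partial>expm l)"

lemma exp_diff_eq:
  assumes "tame y" "0 < l"
  shows "exp_diff l y t = y t - (\<integral>u. y (t - u) \<partial>expm l)"
proof -
  interpret prob_space "expm l" by (rule prob_space_expm) fact
  show ?thesis
    unfolding exp_diff_def using tame_integrable_shift(1)[OF assms] prob_space by simp
qed

text \<open>Invariance of the class is what allows the operator to be iterated. Continuity comes
  from dominated convergence, growth from the second moment of the exponential law.\<close>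

lemma tame_exp_diff:
  assumes y: "tame y" and l: "0 < l"
  shows "tame (exp_diff l y)"
proof -
  interpret prob_space "expm l" by (rule prob_space_expm) fact
  note [measurable] = tame_measurable[OF y]
  obtain C where C: "0 \<le> C" "continuous_on UNIV y" "\<And>t. \<bar>y t\<bar> \<le> C * (1 + \<bar>t\<bar>) ^ 2"
    using tameE[OF y] by metis
  note le = tame_shift_le[OF C(3,1)]
  define m where "m = (\<integral>u. (1 + \<bar>u\<bar>) ^ 2 \<partial>expm l)"
  have cont: "continuous_on UNIV (\<lambda>t. \<integral>u. y (t - u) \<partial>expm l)"
  proof (rule continuous_at_imp_continuous_on, intro ballI)
    fix t
    have "\<forall>x. (\<lambda>n. x n) \<longlonglongrightarrow> t \<longrightarrow> (\<lambda>n. \<integral>u. y (x n - u) \<partial>expm l) \<longlonglongrightarrow> (\<integral>u. y (t - u) \<partial>expm l)"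
    proof (intro allI impI)
      fix x :: "nat \<Rightarrow> real" assume x: "x \<longlonglongrightarrow> t"
      \<comment> \<open>A convergent sequence is bounded, which gives one majorant for all
        \<open>n\<close>.\<close>
      then have "Bseq x" by (rule convergent_imp_Bseq[OF convergentI])
      then obtain K where K: "\<And>n. \<bar>x n\<bar> \<le> K" by (auto simp: Bseq_def)
      show "(\<lambda>n. \<integral>u. y (x n - u) \<partial>expm l) \<longlonglongrightarrow> (\<integral>u. y (t - u) \<partial>expm l)"
      proof (rule integral_dominated_convergence[where w = "\<lambda>u. C * (1 + K) ^ 2 * (1 + \<bar>u\<bar>) ^ 2"])
        show "integrable (expm l) (\<lambda>u. C * (1 + K) ^ 2 * (1 + \<bar>u\<bar>) ^ 2)"
          using integrable_expm_power[OF l] by simp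
        show "AE u in expm l. (\<lambda>n. y (x n - u)) \<longlonglongrightarrow> y (t - u)"
        proof (intro always_eventually allI)
          fix u
          have "isCont y (t - u)" using C(2) by (simp add: continuous_on_eq_continuous_at)
          moreover have "(\<lambda>n. x n - u) \<longlonglongrightarrow> t - u" using x by (intro tendsto_intros)
          ultimately show "(\<lambda>n. y (x n - u)) \<longlonglongrightarrow> y (t - u)" by (rule isCont_tendsto_compose)
        qed
        show "AE u in expm l. norm (y (x n - u)) \<le> C * (1 + K) ^ 2 * (1 + \<bar>u\<bar>) ^ 2" for n
        proof (intro always_eventually allI)
          fix u
          have "C * (1 + \<bar>x n\<bar>) ^ 2 * (1 + \<bar>u\<bar>) ^ 2 \<le> C * (1 + K) ^ 2 * (1 + \<bar>u\<bar>) ^ 2"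
            using K[of n] C(1) by (intro mult_right_mono mult_left_mono power_mono) auto
          then show "norm (y (x n - u)) \<le> C * (1 + K) ^ 2 * (1 + \<bar>u\<bar>) ^ 2"
            using le[of "x n" u] by simp
        qed
      qed auto
    qed
    then show "isCont (\<lambda>t. \<integral>u. y (t - u) \<partial>expm l) t"
      by (auto simp: isCont_def tendsto_at_iff_sequentially o_def)
  qed
  have "\<bar>exp_diff l y t\<bar> \<le> (C + C * m) * (1 + \<bar>t\<bar>) ^ 2" for t
  proof -
    have "\<bar>\<integral>u. y (t - u) \<partial>expm l\<bar> \<le> (\<integral>u. \<bar>y (t - u)\<bar> \<partial>expm l)"
      by simp
    also have "\<dots> \<le> (\<integral>u. C * (1 + \<bar>t\<bar>) ^ 2 * (1 + \<bar>u\<bar>) ^ 2 \<partial>expm l)"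
      using tame_integrable_shift(1)[OF y l] integrable_expm_power[OF l]
      by (intro integral_mono le) auto
    also have "\<dots> = C * (1 + \<bar>t\<bar>) ^ 2 * m" by (simp add: m_def)
    finally show ?thesis
      using C(3)[of t] abs_triangle_ineq4[of "y t" "\<integral>u. y (t - u) \<partial>expm l"]
      by (simp add: exp_diff_eq[OF y l] algebra_simps)
  qed
  moreover have "continuous_on UNIV (exp_diff l y)"
    using C(2) cont by (simp add: exp_diff_eq[OF y l, abs_def] continuous_on_diff)
  ultimately show ?thesis unfolding tame_def by blast
qed

section \<open>Riemann-Stieltjes integrals against continuous paths\<close>

text \<open>The path may have unbounded variation, so existence rests on the smooth integrand. Since
  \<open>f\<close> is monotone, the error on each cell is at most \<open>\<eta>\<close> times the
  increment of \<open>f\<close>, and these bounds telescope.\<close>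

lemma has_RS_integral_by_parts:
  fixes f f' y :: "real \<Rightarrow> real"
  assumes "a \<le> t"
    and deriv: "\<And>x. (f has_real_derivative f' x) (at x)"
    and f'_cont: "continuous_on UNIV f'" and f'_nonneg: "\<And>x. 0 \<le> f' x"
    and y_cont: "continuous_on UNIV y"
  shows "has_RS_integral f y (f t * y t - f a * y a - integral {a..t} (\<lambda>s. f' s * y s)) a t"
proof -
  have FTC: "(f' has_integral (f v - f u)) {u..v}" if "u \<le> v" for u v
    using that deriv by (intro fundamental_theorem_of_calculus)
      (auto simp flip: has_real_derivative_iff_has_vector_derivative intro: has_field_derivative_at_within)
  have int: "(\<lambda>s. f' s * y s) integrable_on {u..v}" for u v
    using f'_cont y_cont
    by (intro integrable_continuous_interval continuous_on_mult) (auto intro: continuous_on_subset)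
  have mono: "f u \<le> f v" if "u \<le> v" for u v
    using has_integral_nonneg[OF FTC[OF that]] f'_nonneg by auto
  \<comment> \<open>On both sides of a tag the integrator is compared with its value at the nearer partition point,
    so no summation by parts is needed.\<close>
  have piece: "\<bar>integral {u..v} (\<lambda>s. f' s * y s) - c * (f v - f u)\<bar> \<le> \<eta> * (f v - f u)"
    if "u \<le> v" and c: "\<And>s. s \<in> {u..v} \<Longrightarrow> \<bar>y s - c\<bar> \<le> \<eta>" for u v c \<eta>
  proof -
    have 1: "((\<lambda>s. f' s * y s - c * f' s) has_integral
        integral {u..v} (\<lambda>s. f' s * y s) - c * (f v - f u)) {u..v}"
      by (intro has_integral_diff integrable_integral int has_integral_mult_right FTC that)
    have 2: "((\<lambda>s. \<eta> * f' s) has_integral \<eta> * (f v - f u)) {u..v}"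
      by (intro has_integral_mult_right FTC that)
    have "norm (integral {u..v} (\<lambda>s. f' s * y s - c * f' s)) \<le> integral {u..v} (\<lambda>s. \<eta> * f' s)"
    proof (rule integral_norm_bound_integral)
      fix s assume "s \<in> {u..v}"
      then have "\<bar>y s - c\<bar> * f' s \<le> \<eta> * f' s" by (intro mult_right_mono c f'_nonneg)
      then show "norm (f' s * y s - c * f' s) \<le> \<eta> * f' s"
        using f'_nonneg[of s] abs_mult[of "y s - c" "f' s"] by (simp add: algebra_simps)
    qed (use 1 2 in auto)
    then show ?thesis by (simp only: integral_unique[OF 1] integral_unique[OF 2] real_norm_def)
  qed
  show ?thesis
    unfolding has_RS_integral_def
  proof (intro allI impI)
    fix \<epsilon> :: real assume \<epsilon>: "0 < \<epsilon>"
    \<comment> \<open>The total error will be \<open>\<eta> * (f t - f a)\<close>; the summand 1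
      keeps the denominator positive when \<open>f\<close> is constant on the interval.\<close>
    define \<eta> where "\<eta> = \<epsilon> / (f t - f a + 1)"
    have K: "0 < f t - f a + 1" using mono[OF \<open>a \<le> t\<close>] by simp
    then have "0 < \<eta>" using \<epsilon> by (simp add: \<eta>_def)
    have "uniformly_continuous_on {a..t} y"
      using y_cont by (intro compact_uniformly_continuous) (auto intro: continuous_on_subset)
    then obtain \<delta> where \<delta>: "0 < \<delta>"
      "\<And>r s. r \<in> {a..t} \<Longrightarrow> s \<in> {a..t} \<Longrightarrow> \<bar>s - r\<bar> < \<delta> \<Longrightarrow> \<bar>y s - y r\<bar> < \<eta>"
      using \<open>0 < \<eta>\<close> unfolding uniformly_continuous_on_def dist_real_def by metis
    show "\<exists>\<delta>>0. \<forall>n x \<xi>. x 0 = a \<and> x n = t \<and>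
        (\<forall>i<n. x i \<le> \<xi> i \<and> \<xi> i \<le> x (Suc i) \<and> x (Suc i) - x i < \<delta>) \<longrightarrow>
        \<bar>(\<Sum>i<n. f (\<xi> i) * (y (x (Suc i)) - y (x i))) -
          (f t * y t - f a * y a - integral {a..t} (\<lambda>s. f' s * y s))\<bar> < \<epsilon>"
    proof (intro exI[of _ \<delta>] conjI allI impI \<delta>(1))
      fix n and x \<xi> :: "nat \<Rightarrow> real"
      assume "x 0 = a \<and> x n = t \<and>
        (\<forall>i<n. x i \<le> \<xi> i \<and> \<xi> i \<le> x (Suc i) \<and> x (Suc i) - x i < \<delta>)"
      then have x: "x 0 = a" "x n = t"
        and \<xi>: "\<And>i. i < n \<Longrightarrow> x i \<le> \<xi> i" "\<And>i. i < n \<Longrightarrow> \<xi> i \<le> x (Suc i)"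
        and mesh: "\<And>i. i < n \<Longrightarrow> x (Suc i) - x i < \<delta>" by auto
      let ?F = "\<lambda>s. f' s * y s"
      have xmono: "x i \<le> x j" if "i \<le> j" "j \<le> n" for i j
        using that
      proof (induction j rule: dec_induct)
        case (step m) then show ?case using \<xi>[of m] by simp
      qed simp
      have range: "x i \<in> {a..t}" if "i \<le> n" for i
        using xmono[of 0 i] xmono[of i n] that x by auto
      have split: "integral {x 0..x m} ?F = (\<Sum>i<m. integral {x i..x (Suc i)} ?F)" if "m \<le> n" for m
        using that
      proof (induction m)
        case (Suc m)
        have "integral {x 0..x m} ?F + integral {x m..x (Suc m)} ?F = integral {x 0..x (Suc m)} ?F"
          using Suc.prems xmono by (intro Henstock_Kurzweil_Integration.integral_combine int) auto
        then show ?case using Suc by simp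
      qed simp
      \<comment> \<open>The discrepancy on one cell: its boundary terms telescope and its integrals
        add up, so the sum over cells is the global discrepancy.\<close>
      let ?e = "\<lambda>i. f (\<xi> i) * (y (x (Suc i)) - y (x i))
          - (f (x (Suc i)) * y (x (Suc i)) - f (x i) * y (x i)) + integral {x i..x (Suc i)} ?F"
      have e: "\<bar>?e i\<bar> \<le> \<eta> * (f (x (Suc i)) - f (x i))" if i: "i < n" for i
      proof -
        have near: "\<bar>y s - y r\<bar> \<le> \<eta>" if "s \<in> {x i..x (Suc i)}" "r \<in> {x i..x (Suc i)}" for r s
          using that mesh[OF i] range[of i] range[of "Suc i"] i
          by (intro less_imp_le \<delta>(2)) auto
        have 1: "\<bar>integral {x i..\<xi> i} ?F - y (x i) * (f (\<xi> i) - f (x i))\<bar> \<le> \<eta> * (f (\<xi> i) - f (x i))"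
          using \<xi>[OF i] by (intro piece near) auto
        have 2: "\<bar>integral {\<xi> i..x (Suc i)} ?F - y (x (Suc i)) * (f (x (Suc i)) - f (\<xi> i))\<bar>
            \<le> \<eta> * (f (x (Suc i)) - f (\<xi> i))"
          using \<xi>[OF i] by (intro piece near) auto
        have "integral {x i..\<xi> i} ?F + integral {\<xi> i..x (Suc i)} ?F = integral {x i..x (Suc i)} ?F"
          using \<xi>[OF i] by (intro Henstock_Kurzweil_Integration.integral_combine int) auto
        then have "?e i = (integral {x i..\<xi> i} ?F - y (x i) * (f (\<xi> i) - f (x i)))
            + (integral {\<xi> i..x (Suc i)} ?F - y (x (Suc i)) * (f (x (Suc i)) - f (\<xi> i)))"
          by (simp add: algebra_simps)
        moreover have "\<eta> * (f (x (Suc i)) - f (x i))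
            = \<eta> * (f (\<xi> i) - f (x i)) + \<eta> * (f (x (Suc i)) - f (\<xi> i))"
          by (simp add: algebra_simps)
        ultimately show ?thesis using 1 2 by linarith
      qed
      have eq: "(\<Sum>i<n. f (\<xi> i) * (y (x (Suc i)) - y (x i))) -
          (f t * y t - f a * y a - integral {a..t} ?F) = (\<Sum>i<n. ?e i)"
        using split[of n] sum_lessThan_telescope[of "\<lambda>i. f (x i) * y (x i)" n] x
        by (simp add: sum.distrib sum_subtractf)
      have "\<bar>\<Sum>i<n. ?e i\<bar> \<le> (\<Sum>i<n. \<eta> * (f (x (Suc i)) - f (x i)))"
        using e by (intro order_trans[OF sum_abs] sum_mono) auto
      also have "\<dots> = \<eta> * (f t - f a)"
        by (subst sum_distrib_left[symmetric]) (simp add: sum_lessThan_telescope[of "\<lambda>i. f (x i)"] x)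
      also have "\<dots> < \<epsilon>"
        using \<epsilon> K by (simp add: \<eta>_def field_simps)
      finally show "\<bar>(\<Sum>i<n. f (\<xi> i) * (y (x (Suc i)) - y (x i))) -
          (f t * y t - f a * y a - integral {a..t} ?F)\<bar> < \<epsilon>" unfolding eq .
    qed
  qed
qed

text \<open>Fine partitions must be exhibited, or the limit condition would be vacuous: equal steps,
  tagged at their left ends, with mesh below both thresholds.\<close>

lemma has_RS_integral_unique:
  assumes "a \<le> b" "has_RS_integral f g I a b" "has_RS_integral f g I' a b"
  shows "I = I'"
proof (rule ccontr)
  assume "I \<noteq> I'"
  define \<epsilon> where "\<epsilon> = \<bar>I - I'\<bar> / 2"
  have \<epsilon>: "0 < \<epsilon>" using \<open>I \<noteq> I'\<close> by (simp add: \<epsilon>_def)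
  let ?P = "\<lambda>I \<delta>. \<forall>(n::nat) (x :: nat \<Rightarrow> real) (\<xi> :: nat \<Rightarrow> real).
        x 0 = a \<and> x n = b \<and>
        (\<forall>i<n. x i \<le> \<xi> i \<and> \<xi> i \<le> x (Suc i) \<and> x (Suc i) - x i < \<delta>) \<longrightarrow>
        \<bar>(\<Sum>i<n. f (\<xi> i) * (g (x (Suc i)) - g (x i))) - I\<bar> < \<epsilon>"
  obtain \<delta> where \<delta>: "0 < \<delta>" "?P I \<delta>"
    using assms(2)[unfolded has_RS_integral_def, rule_format, OF \<epsilon>] by blast
  obtain \<delta>' where \<delta>': "0 < \<delta>'" "?P I' \<delta>'"
    using assms(3)[unfolded has_RS_integral_def, rule_format, OF \<epsilon>] by blast
  obtain m :: nat where m: "(b - a) / min \<delta> \<delta>' < real m" using reals_Archimedean2 by blast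
  define n where "n = Suc m"
  have "(b - a) / min \<delta> \<delta>' < real n" using m by (simp add: n_def)
  moreover have "0 < min \<delta> \<delta>'" "0 < real n" using \<delta>(1) \<delta>'(1) by (auto simp: n_def)
  ultimately have n: "(b - a) / real n < min \<delta> \<delta>'"
    by (metis pos_divide_less_eq mult.commute)
  define x where "x i = a + real i * ((b - a) / real n)" for i
  have step: "x (Suc i) - x i = (b - a) / real n" for i by (simp add: x_def distrib_right add_divide_distrib)
  have le: "x i \<le> x (Suc i)" for i using step[of i] assms(1) divide_nonneg_nonneg[of "b - a" "real n"] by linarith
  have ends: "x 0 = a" "x n = b" by (simp_all add: x_def n_def)
  have "\<bar>(\<Sum>i<n. f (x i) * (g (x (Suc i)) - g (x i))) - I\<bar> < \<epsilon>"
    using \<delta>(2)[rule_format, of x n x] ends le step n by simp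
  moreover have "\<bar>(\<Sum>i<n. f (x i) * (g (x (Suc i)) - g (x i))) - I'\<bar> < \<epsilon>"
    using \<delta>'(2)[rule_format, of x n x] ends le step n by simp
  ultimately show False unfolding \<epsilon>_def by (simp add: abs_if split: if_splits)
qed

lemma has_RS_integral_at_bot_unique:
  assumes "has_RS_integral_at_bot f g I t" "has_RS_integral_at_bot f g I' t"
  shows "I = I'"
proof -
  obtain J J' where J: "\<And>a. a \<le> t \<Longrightarrow> has_RS_integral f g (J a) a t" "(J \<longlongrightarrow> I) at_bot"
    and J': "\<And>a. a \<le> t \<Longrightarrow> has_RS_integral f g (J' a) a t" "(J' \<longlongrightarrow> I') at_bot"
    using assms unfolding has_RS_integral_at_bot_def by auto
  have "eventually (\<lambda>a. J a = J' a) at_bot"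
    using eventually_le_at_bot[of t] by eventually_elim (auto intro: has_RS_integral_unique J J')
  then have "(J' \<longlongrightarrow> I) at_bot" using J(2) by (rule Lim_transform_eventually[rotated])
  then show ?thesis using J'(2) tendsto_unique[OF trivial_limit_at_bot_linorder] by blast
qed

text \<open>After integration by parts the boundary term at minus infinity vanishes, because the
  exponential beats quadratic growth. The substitution \<open>u = t - s\<close> turns the remaining
  integral into an exponential average; uniqueness of the improper integral resolves
  \<open>THE\<close>.\<close>

lemma OU_op_eq_exp_diff:
  assumes y: "tame y" and l: "0 < l"
  shows "OU_op l y t = exp_diff l y t"
proof -
  obtain C where C: "0 \<le> C" "continuous_on UNIV y" "\<And>t. \<bar>y t\<bar> \<le> C * (1 + \<bar>t\<bar>) ^ 2"
    using tameE[OF y] by metis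
  note [measurable] = tame_measurable[OF y]
  let ?f = "\<lambda>s. exp (- l * (t - s))"
  let ?F = "\<lambda>s. l * exp (- l * (t - s)) * y s"
  \<comment> \<open>The exponential density vanishes at negative arguments, so \<open>?G\<close> is
    \<open>?F\<close> cut off to \<open>{..t}\<close>.\<close>
  let ?G = "\<lambda>s. exponential_density l (t - s) * y s"
  have RS: "has_RS_integral ?f y (y t - ?f a * y a - integral {a..t} ?F) a t" if "a \<le> t" for a
  proof -
    have "has_RS_integral ?f y (?f t * y t - ?f a * y a - integral {a..t} ?F) a t"
    proof (rule has_RS_integral_by_parts[OF that])
      show "(?f has_real_derivative l * exp (- l * (t - x))) (at x)" for x
        by (auto intro!: derivative_eq_intros)
      show "continuous_on UNIV (\<lambda>s. l * exp (- l * (t - s)))" by (intro continuous_intros)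
      show "0 \<le> l * exp (- l * (t - s))" for s using l by simp
    qed (rule C(2))
    then show ?thesis by simp
  qed
  have lim1: "((\<lambda>a. ?f a * y a) \<longlongrightarrow> 0) at_bot"
  proof (rule Lim_null_comparison)
    show "\<forall>\<^sub>F a in at_bot. norm (?f a * y a) \<le> exp (- l * (t - a)) * (C * (1 - a) ^ 2)"
      using eventually_le_at_bot[of 0]
    proof eventually_elim
      case (elim a)
      then have "\<bar>y a\<bar> \<le> C * (1 - a) ^ 2" using C(3)[of a] by simp
      then show ?case by (simp add: abs_mult)
    qed
    show "((\<lambda>a. exp (- l * (t - a)) * (C * (1 - a) ^ 2)) \<longlongrightarrow> 0) at_bot"
      using l by real_asymp
  qed
  have "integrable (expm l) (\<lambda>u. y (t - u))" by (rule tame_integrable_shift(1)[OF y l])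
  then have "integrable lborel (\<lambda>u. exponential_density l u * y (t - u))"
    unfolding expm_def using l
    by (subst (asm) integrable_density) (auto simp: exponential_density_nonneg)
  from lborel_integrable_real_affine[OF this, of "- 1" t]
  have intG: "integrable lborel ?G" by simp
  have "(\<integral>u. y (t - u) \<partial>expm l) = (\<integral>u. exponential_density l u * y (t - u) \<partial>lborel)"
    unfolding expm_def using l
    by (subst integral_density) (auto simp: exponential_density_nonneg)
  also have "\<dots> = (\<integral>s. ?G s \<partial>lborel)"
    using lborel_integral_real_affine[of "- 1" "\<lambda>u. exponential_density l u * y (t - u)" t] by simp
  also have "\<dots> = (LINT s:{..t}|lborel. ?F s)"
    unfolding set_lebesgue_integral_def
    by (intro Bochner_Integration.integral_cong)
      (auto simp: exponential_density_def indicator_def algebra_simps)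
  finally have E: "(\<integral>u. y (t - u) \<partial>expm l) = (LINT s:{..t}|lborel. ?F s)" .
  have "?G = (\<lambda>s. indicator {..t} s *\<^sub>R ?F s)"
    by (auto simp: exponential_density_def indicator_def algebra_simps)
  with intG have setint: "set_integrable lborel {..t} ?F" unfolding set_integrable_def by metis
  then have "((\<lambda>a. LINT s:{a..t}|lborel. ?F s) \<longlongrightarrow> (LINT s:{..t}|lborel. ?F s)) at_bot"
    by (intro tendsto_set_lebesgue_integral_at_bot) auto
  moreover have "(LINT s:{a..t}|lborel. ?F s) = integral {a..t} ?F" for a
    by (intro set_borel_integral_eq_integral set_integrable_subset[OF setint]) auto
  ultimately have lim2: "((\<lambda>a. integral {a..t} ?F) \<longlongrightarrow> (\<integral>u. y (t - u) \<partial>expm l)) at_bot"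
    by (simp add: E)
  have "((\<lambda>a. y t - ?f a * y a - integral {a..t} ?F) \<longlongrightarrow> y t - 0 - (\<integral>u. y (t - u) \<partial>expm l)) at_bot"
    by (intro tendsto_diff lim1 lim2 tendsto_const)
  then have "has_RS_integral_at_bot ?f y (exp_diff l y t) t"
    unfolding has_RS_integral_at_bot_def exp_diff_eq[OF y l] using RS
    by (intro exI[of _ "\<lambda>a. y t - ?f a * y a - integral {a..t} ?F"]) auto
  then show ?thesis
    unfolding OU_op_def by (intro the_equality) (auto intro: has_RS_integral_at_bot_unique)
qed

section \<open>The operator on second-order processes\<close>

text \<open>For covariance \<open>g (s - t)\<close> this is, at \<open>h = s - t\<close>, the
  covariance of the increments \<open>Y s - Y (s - u)\<close> and
  \<open>Y t - Y (t - v)\<close>.\<close>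

definition mixed_diff :: "real \<Rightarrow> real \<Rightarrow> (real \<Rightarrow> real) \<Rightarrow> real \<Rightarrow> real" where
  "mixed_diff u v g h = g h - g (h - u) - g (h + v) + g (h - u + v)"

text \<open>If a process has covariance \<open>g(s - t)\<close>, its image under \<open>T\<^sub>\<lambda>\<close> has covariance \<open>cov_op \<lambda> g (s - t)\<close>:
  the two time variables are differenced independently.\<close>
definition cov_op :: "real \<Rightarrow> (real \<Rightarrow> real) \<Rightarrow> real \<Rightarrow> real" where
  "cov_op l g h = (\<integral>v. \<integral>u. mixed_diff u v g h \<partial>expm l \<partial>expm l)"

section \<open>Joint measurability and Fubini\<close>

text \<open>Dyadic approximation in time serves twice: for joint measurability and for the chaining
  of increments.\<close>

lemma dyadic_floor_tendsto: "(\<lambda>k. real_of_int \<lfloor>2 ^ k * t\<rfloor> / 2 ^ k) \<longlonglongrightarrow> t"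
proof -
  have lim: "(\<lambda>k. 1 / 2 ^ k) \<longlonglongrightarrow> (0::real)"
    using LIMSEQ_power_zero[of "1/2::real"] by (simp add: power_divide)
  have "norm (real_of_int \<lfloor>2 ^ k * t\<rfloor> / 2 ^ k - t) \<le> 1 / 2 ^ k" for k
  proof -
    have "\<bar>real_of_int \<lfloor>2 ^ k * t\<rfloor> - 2 ^ k * t\<bar> \<le> 1" by linarith
    then have "\<bar>real_of_int \<lfloor>2 ^ k * t\<rfloor> - 2 ^ k * t\<bar> / 2 ^ k \<le> 1 / 2 ^ k"
      by (intro divide_right_mono) auto
    moreover have "real_of_int \<lfloor>2 ^ k * t\<rfloor> / 2 ^ k - t = (real_of_int \<lfloor>2 ^ k * t\<rfloor> - 2 ^ k * t) / 2 ^ k"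
      by (simp add: diff_divide_distrib)
    ultimately show ?thesis by (simp add: abs_divide)
  qed
  then have "(\<lambda>k. real_of_int \<lfloor>2 ^ k * t\<rfloor> / 2 ^ k - t) \<longlonglongrightarrow> 0"
    by (intro Lim_null_comparison[OF _ lim] always_eventually allI)
  then show ?thesis by (rule LIM_zero_cancel)
qed

text \<open>Continuity makes the process a pointwise limit of processes that are piecewise constant
  in time. Each of these takes its time from a countable grid and is thus jointly
  measurable.\<close>

lemma measurable_continuous_process:
  fixes Y :: "real \<Rightarrow> 'a \<Rightarrow> real"
  assumes "\<And>w. continuous_on UNIV (\<lambda>t. Y t w)" and Y [measurable]: "\<And>t. Y t \<in> borel_measurable M"
  shows "(\<lambda>x. Y (fst x) (snd x)) \<in> borel_measurable (borel \<Otimes>\<^sub>M M)"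
proof (rule borel_measurable_LIMSEQ_real)
  fix x :: "real \<times> 'a"
  have "isCont (\<lambda>t. Y t (snd x)) (fst x)"
    using assms(1) by (simp add: continuous_on_eq_continuous_at)
  then show "(\<lambda>k. Y (real_of_int \<lfloor>(2::real) ^ k * fst x\<rfloor> / (2::real) ^ k) (snd x)) \<longlonglongrightarrow> Y (fst x) (snd x)"
    by (rule isCont_tendsto_compose) (rule dyadic_floor_tendsto)
next
  fix k :: nat
  have fl: "(\<lambda>x. \<lfloor>(2::real) ^ k * fst x\<rfloor>) \<in> borel \<Otimes>\<^sub>M M \<rightarrow>\<^sub>M count_space (UNIV :: int set)"
    by measurable
  have "(\<lambda>x. (\<lambda>i x. Y (real_of_int i / 2 ^ k) (snd x)) \<lfloor>(2::real) ^ k * fst x\<rfloor> x) \<in> borel_measurable (borel \<Otimes>\<^sub>M M)"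
    by (rule measurable_compose_countable[OF measurable_compose[OF measurable_snd Y] fl])
  then show "(\<lambda>x. Y (real_of_int \<lfloor>(2::real) ^ k * fst x\<rfloor> / (2::real) ^ k) (snd x)) \<in> borel_measurable (borel \<Otimes>\<^sub>M M)"
    by simp
qed

lemma mult_le_add_squares: "\<bar>x * y\<bar> \<le> x\<^sup>2 + (y::real)\<^sup>2"
proof -
  have "2 * (\<bar>x\<bar> * \<bar>y\<bar>) \<le> x\<^sup>2 + y\<^sup>2" using sum_squares_bound[of "\<bar>x\<bar>" "\<bar>y\<bar>"] by (simp add: mult.assoc)
  moreover have "0 \<le> \<bar>x\<bar> * \<bar>y\<bar>" by simp
  ultimately show ?thesis unfolding abs_mult by linarith
qed

lemma diff_square_le: "(x - y)\<^sup>2 \<le> 2 * x\<^sup>2 + 2 * (y::real)\<^sup>2"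
  using zero_le_power2[of "x + y"] by (simp add: power2_sum power2_diff)

lemma integrable_mult_square:
  fixes f g :: "'a \<Rightarrow> real"
  assumes [measurable]: "f \<in> borel_measurable M" "g \<in> borel_measurable M"
    and "integrable M (\<lambda>x. (f x)\<^sup>2)" "integrable M (\<lambda>x. (g x)\<^sup>2)"
  shows "integrable M (\<lambda>x. f x * g x)"
proof (rule Bochner_Integration.integrable_bound)
  show "integrable M (\<lambda>x. (f x)\<^sup>2 + (g x)\<^sup>2)" using assms by simp
  show "AE x in M. norm (f x * g x) \<le> norm ((f x)\<^sup>2 + (g x)\<^sup>2)"
    unfolding real_norm_def
    by (intro always_eventually allI order_trans[OF mult_le_add_squares abs_ge_self])
qed simp

lemma integrable_diff_square:
  fixes f g :: "'a \<Rightarrow> real"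
  assumes [measurable]: "f \<in> borel_measurable M" "g \<in> borel_measurable M"
    and "integrable M (\<lambda>x. (f x)\<^sup>2)" "integrable M (\<lambda>x. (g x)\<^sup>2)"
  shows "integrable M (\<lambda>x. (f x - g x)\<^sup>2)"
  using assms integrable_mult_square[OF assms] by (simp add: power2_diff mult.assoc)

text \<open>The term \<open>\<alpha>\<close> covers the nonstationary covariance of fractional Brownian motion;
  it is killed by the first differencing.\<close>
locale tame_process = prob_space M for M :: "'a measure" +
  fixes Y :: "real \<Rightarrow> 'a \<Rightarrow> real" and \<alpha> g :: "real \<Rightarrow> real"
  assumes tame: "\<And>w. tame (\<lambda>t. Y t w)"
    and meas [measurable]: "\<And>t. Y t \<in> borel_measurable M"
    and sq_int: "\<And>t. integrable M (\<lambda>w. (Y t w)\<^sup>2)"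
    and var_le: "\<exists>D. \<forall>t. (\<integral>w. (Y t w)\<^sup>2 \<partial>M) \<le> D * (1 + \<bar>t\<bar>) ^ 2"
    and mean: "\<And>t. (\<integral>w. Y t w \<partial>M) = 0"
    and cov: "\<And>s t. (\<integral>w. Y s w * Y t w \<partial>M) = \<alpha> s + \<alpha> t + g (s - t)"
begin

lemma measurable_shift:
  "(\<lambda>x. Y (t - fst x) (snd x)) \<in> borel_measurable (expm l \<Otimes>\<^sub>M M)"
proof -
  have "(\<lambda>x. Y (fst x) (snd x)) \<in> borel_measurable (borel \<Otimes>\<^sub>M M)"
    using tame by (intro measurable_continuous_process meas) (auto simp: tame_def)
  moreover have "(\<lambda>x. (t - fst x, snd x)) \<in> expm l \<Otimes>\<^sub>M M \<rightarrow>\<^sub>M borel \<Otimes>\<^sub>M M"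
    by measurable
  ultimately show ?thesis
    using measurable_compose[of "\<lambda>x. (t - fst x, snd x)" _ _ "\<lambda>x. Y (fst x) (snd x)"] by simp
qed

lemma measurable_increment:
  "(\<lambda>x. Y t (snd x) - Y (t - fst x) (snd x)) \<in> borel_measurable (expm l \<Otimes>\<^sub>M M)"
  by (intro borel_measurable_diff measurable_compose[OF measurable_snd meas] measurable_shift)

text \<open>Square integrability on the product space is the input for the later exchanges of
  expectation and time average. The inner expectation is at most a constant times
  \<open>(1 + \<bar>t\<bar>) ^ 2 * (1 + \<bar>u\<bar>) ^ 2\<close>, by the variance bound.\<close>

lemma integrable_increment_square:
  assumes l: "0 < l"
  shows "integrable (expm l \<Otimes>\<^sub>M M) (\<lambda>x. (Y t (snd x) - Y (t - fst x) (snd x))\<^sup>2)"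
proof -
  interpret E: prob_space "expm l" by (rule prob_space_expm[OF l])
  interpret P: pair_prob_space "expm l" M ..
  obtain D where D: "\<And>t. (\<integral>w. (Y t w)\<^sup>2 \<partial>M) \<le> D * (1 + \<bar>t\<bar>) ^ 2" using var_le by auto
  have "0 \<le> D" using order_trans[OF _ D[of 0]] by simp
  show ?thesis
  proof (rule P.Fubini_integrable)
    have meas_norm: "(\<lambda>u. \<integral>w. norm ((Y t w - Y (t - u) w)\<^sup>2) \<partial>M) \<in> borel_measurable (expm l)"
      unfolding real_norm_def abs_power2
      using borel_measurable_power[OF measurable_increment, where n = 2]
      by (intro borel_measurable_lebesgue_integral) (simp only: split_beta')
    have bound: "norm (\<integral>w. norm ((Y t w - Y (t - u) w)\<^sup>2) \<partial>M)
        \<le> 2 * D * (1 + \<bar>t\<bar>) ^ 2 + 2 * D * (1 + \<bar>t\<bar>) ^ 2 * (1 + \<bar>u\<bar>) ^ 2" for u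
    proof -
      have "(\<integral>w. norm ((Y t w - Y (t - u) w)\<^sup>2) \<partial>M) \<le> (\<integral>w. 2 * (Y t w)\<^sup>2 + 2 * (Y (t - u) w)\<^sup>2 \<partial>M)"
        by (intro integral_mono integrable_norm integrable_diff_square[OF meas meas sq_int sq_int]
          Bochner_Integration.integrable_add integrable_mult_right sq_int) (simp add: diff_square_le)
      also have "\<dots> = 2 * (\<integral>w. (Y t w)\<^sup>2 \<partial>M) + 2 * (\<integral>w. (Y (t - u) w)\<^sup>2 \<partial>M)"
        using sq_int by simp
      finally have le: "(\<integral>w. norm ((Y t w - Y (t - u) w)\<^sup>2) \<partial>M)
          \<le> 2 * (\<integral>w. (Y t w)\<^sup>2 \<partial>M) + 2 * (\<integral>w. (Y (t - u) w)\<^sup>2 \<partial>M)" by simp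
      have "(\<integral>w. (Y (t - u) w)\<^sup>2 \<partial>M) \<le> D * (1 + \<bar>t\<bar>) ^ 2 * (1 + \<bar>u\<bar>) ^ 2"
        using order_trans[OF D[of "t - u"] mult_left_mono[OF one_plus_abs_diff_power_le \<open>0 \<le> D\<close>]]
        by (simp only: mult.assoc)
      then show ?thesis
        unfolding real_norm_def[of "integral\<^sup>L M _"]
          abs_of_nonneg[OF Bochner_Integration.integral_nonneg[of M "\<lambda>w. norm ((Y t w - Y (t - u) w)\<^sup>2)", OF norm_ge_zero]]
        using le D[of t] by linarith
    qed
    show "integrable (expm l) (\<lambda>u. \<integral>w. norm ((Y t (snd (u, w)) - Y (t - fst (u, w)) (snd (u, w)))\<^sup>2) \<partial>M)"
    proof (rule Bochner_Integration.integrable_bound)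
      show "integrable (expm l) (\<lambda>u. 2 * D * (1 + \<bar>t\<bar>) ^ 2 + 2 * D * (1 + \<bar>t\<bar>) ^ 2 * (1 + \<bar>u\<bar>) ^ 2)"
        using integrable_expm_power[OF l] by simp
      show "AE u in expm l. norm (\<integral>w. norm ((Y t (snd (u, w)) - Y (t - fst (u, w)) (snd (u, w)))\<^sup>2) \<partial>M)
          \<le> norm (2 * D * (1 + \<bar>t\<bar>) ^ 2 + 2 * D * (1 + \<bar>t\<bar>) ^ 2 * (1 + \<bar>u\<bar>) ^ 2)"
        unfolding fst_conv snd_conv real_norm_def[of "_ + _"]
        by (intro always_eventually allI order_trans[OF bound abs_ge_self])
    qed (simp only: fst_conv snd_conv meas_norm)
    show "(\<lambda>x. (Y t (snd x) - Y (t - fst x) (snd x))\<^sup>2) \<in> borel_measurable (expm l \<Otimes>\<^sub>M M)"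
      by (intro borel_measurable_power measurable_increment)
    show "AE u in expm l. integrable M (\<lambda>w. (Y t (snd (u, w)) - Y (t - fst (u, w)) (snd (u, w)))\<^sup>2)"
      unfolding fst_conv snd_conv
      by (intro always_eventually allI integrable_diff_square meas sq_int)
  qed
qed

abbreviation Z :: "real \<Rightarrow> real \<Rightarrow> 'a \<Rightarrow> real" where
  "Z l t w \<equiv> exp_diff l (\<lambda>s. Y s w) t"

lemma measurable_Z:
  assumes l: "0 < l"
  shows "Z l t \<in> borel_measurable M"
proof -
  interpret E: prob_space "expm l" by (rule prob_space_expm[OF l])
  have "(\<lambda>x. Y t (fst x) - Y (t - snd x) (fst x)) \<in> borel_measurable (M \<Otimes>\<^sub>M expm l)"
    using measurable_compose[OF measurable_pair_swap' measurable_increment[of t l]]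
    by (simp only: split_beta' fst_conv snd_conv)
  then show ?thesis
    unfolding exp_diff_def by (intro E.borel_measurable_lebesgue_integral) (simp only: split_beta')
qed

lemma Z_sq_int:
  assumes l: "0 < l"
  shows "integrable M (\<lambda>w. (Z l t w)\<^sup>2)"
proof -
  interpret E: prob_space "expm l" by (rule prob_space_expm[OF l])
  interpret P: pair_prob_space "expm l" M ..
  have "integrable M (\<lambda>w. \<integral>u. (Y t w - Y (t - u) w)\<^sup>2 \<partial>expm l)"
    using integrable_increment_square[OF l, of t] by (intro P.integrable_snd) (simp only: split_beta')
  moreover {
    fix w
    have "(Z l t w)\<^sup>2 \<le> (\<integral>u. (Y t w - Y (t - u) w)\<^sup>2 \<partial>expm l)"
    proof -
      have 1: "integrable (expm l) (\<lambda>u. Y t w - Y (t - u) w)"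
        by (intro Bochner_Integration.integrable_diff tame_integrable_shift(1)[OF tame l] E.integrable_const)
      have 2: "integrable (expm l) (\<lambda>u. (Y t w - Y (t - u) w)\<^sup>2)"
        by (intro integrable_diff_square tame_integrable_shift(2)[OF tame l] E.integrable_const
          borel_measurable_integrable[OF tame_integrable_shift(1)[OF tame l]]) simp
      \<comment> \<open>Jensen's inequality for the square, in the form that a variance is
        nonnegative.\<close>
      show ?thesis
        using E.variance_positive[of "\<lambda>u. Y t w - Y (t - u) w"]
        unfolding E.variance_eq[OF 1 2] exp_diff_def by linarith
    qed
    then have "norm ((Z l t w)\<^sup>2) \<le> norm (\<integral>u. (Y t w - Y (t - u) w)\<^sup>2 \<partial>expm l)"
      unfolding real_norm_def abs_power2 by (rule order_trans[OF _ abs_ge_self])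
  }
  ultimately show ?thesis
    by (intro Bochner_Integration.integrable_bound[where g = "\<lambda>w. (Z l t w)\<^sup>2"]
      borel_measurable_power measurable_Z l always_eventually allI)
qed

text \<open>Fubini with a general second factor \<open>V\<close>, because it is used with
  \<open>V = 1\<close> for the mean and, for the covariance, with \<open>V\<close> first a value of
  \<open>Y\<close> and then a value of \<open>Z\<close>.\<close>

lemma expectation_times_Z:
  assumes l: "0 < l" and V [measurable]: "V \<in> borel_measurable M"
    and V2: "integrable M (\<lambda>w. (V w)\<^sup>2)"
  shows "integrable (expm l) (\<lambda>u. (\<integral>w. V w * Y t w \<partial>M) - (\<integral>w. V w * Y (t - u) w \<partial>M))"
    and "(\<integral>w. V w * Z l t w \<partial>M) = (\<integral>u. (\<integral>w. V w * Y t w \<partial>M) - (\<integral>w. V w * Y (t - u) w \<partial>M) \<partial>expm l)"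
proof -
  interpret E: prob_space "expm l" by (rule prob_space_expm[OF l])
  interpret P: pair_prob_space "expm l" M ..
  let ?f = "\<lambda>u w. V w * (Y t w - Y (t - u) w)"
  have "integrable (expm l \<Otimes>\<^sub>M M) (\<lambda>x. (V (snd x))\<^sup>2)"
    by (rule P.Fubini_integrable) (use V2 in auto)
  then have "integrable (expm l \<Otimes>\<^sub>M M) (\<lambda>x. V (snd x) * (Y t (snd x) - Y (t - fst x) (snd x)))"
    by (intro integrable_mult_square integrable_increment_square l measurable_increment
      measurable_compose[OF measurable_snd V])
  then have "integrable (expm l \<Otimes>\<^sub>M M) (case_prod ?f)" by (simp add: split_beta')
  note P.Fubini_integral[OF this] P.integrable_fst[OF this]
  moreover have "(\<integral>u. Y t w - Y (t - u) w \<partial>expm l) = Z l t w" for w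
    by (simp add: exp_diff_def)
  moreover have "(\<integral>w. ?f u w \<partial>M) = (\<integral>w. V w * Y t w \<partial>M) - (\<integral>w. V w * Y (t - u) w \<partial>M)" for u
    using integrable_mult_square[OF V meas V2 sq_int] by (simp add: right_diff_distrib)
  ultimately show
    "integrable (expm l) (\<lambda>u. (\<integral>w. V w * Y t w \<partial>M) - (\<integral>w. V w * Y (t - u) w \<partial>M))"
    "(\<integral>w. V w * Z l t w \<partial>M) = (\<integral>u. (\<integral>w. V w * Y t w \<partial>M) - (\<integral>w. V w * Y (t - u) w \<partial>M) \<partial>expm l)"
    by simp_all
qed

lemma Z_mean:
  assumes l: "0 < l"
  shows "(\<integral>w. Z l t w \<partial>M) = 0"
  using expectation_times_Z(2)[OF l, of "\<lambda>_. 1" t] by (simp add: mean)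

lemma Z_cov:
  assumes l: "0 < l"
  shows "(\<integral>w. Z l s w * Z l t w \<partial>M) = cov_op l g (s - t)"
proof -
  interpret E: prob_space "expm l" by (rule prob_space_expm[OF l])
  have incr: "(\<integral>w. Y r w * Y s w \<partial>M) - (\<integral>w. Y r w * Y (s - u) w \<partial>M)
      = \<alpha> s - \<alpha> (s - u) + g (s - r) - g (s - u - r)" for r u
    unfolding mult.commute[of "Y r _"] cov by simp
  \<comment> \<open>The contribution of \<open>\<alpha> r\<close> has cancelled. What remains of
    \<open>\<alpha>\<close> is free of \<open>r\<close> and cancels when the values at
    \<open>r = t\<close> and \<open>r = t - v\<close> are subtracted.\<close>
  have 1: "(\<integral>w. Z l s w * Y r w \<partial>M) = (\<integral>u. \<alpha> s - \<alpha> (s - u) + g (s - r) - g (s - u - r) \<partial>expm l)" for r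
  proof -
    have "(\<integral>w. Z l s w * Y r w \<partial>M) = (\<integral>w. Y r w * Z l s w \<partial>M)" by (simp add: mult.commute)
    also have "\<dots> = (\<integral>u. (\<integral>w. Y r w * Y s w \<partial>M) - (\<integral>w. Y r w * Y (s - u) w \<partial>M) \<partial>expm l)"
      by (rule expectation_times_Z(2)[OF l meas sq_int])
    also have "\<dots> = (\<integral>u. \<alpha> s - \<alpha> (s - u) + g (s - r) - g (s - u - r) \<partial>expm l)"
      unfolding incr ..
    finally show ?thesis .
  qed
  have int: "integrable (expm l) (\<lambda>u. \<alpha> s - \<alpha> (s - u) + g (s - r) - g (s - u - r))" for r
    using expectation_times_Z(1)[OF l meas sq_int, of r s] unfolding incr .
  have "(\<integral>w. Z l s w * Z l t w \<partial>M)
      = (\<integral>v. (\<integral>w. Z l s w * Y t w \<partial>M) - (\<integral>w. Z l s w * Y (t - v) w \<partial>M) \<partial>expm l)"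
    by (rule expectation_times_Z(2)[OF l measurable_Z[OF l] Z_sq_int[OF l]])
  also have "\<dots> = (\<integral>v. \<integral>u. mixed_diff u v g (s - t) \<partial>expm l \<partial>expm l)"
    unfolding 1 Bochner_Integration.integral_diff[OF int int, symmetric]
    by (intro Bochner_Integration.integral_cong refl) (simp add: mixed_diff_def algebra_simps)
  finally show ?thesis by (simp add: cov_op_def)
qed

lemma tame_process_Z:
  assumes l: "0 < l"
  shows "tame_process M (Z l) (\<lambda>_. 0) (cov_op l g)"
proof
  show "tame (\<lambda>t. Z l t w)" for w using tame_exp_diff[OF tame l] by simp
  show "Z l t \<in> borel_measurable M" for t by (rule measurable_Z[OF l])
  show "integrable M (\<lambda>w. (Z l t w)\<^sup>2)" for t by (rule Z_sq_int[OF l])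
  show "(\<integral>w. Z l t w \<partial>M) = 0" for t by (rule Z_mean[OF l])
  show "(\<integral>w. Z l s w * Z l t w \<partial>M) = 0 + 0 + cov_op l g (s - t)" for s t by (simp add: Z_cov[OF l])
  \<comment> \<open>The new covariance depends on \<open>s - t\<close> only, so the variance is the
    constant \<open>cov_op l g 0\<close>.\<close>
  have "(\<integral>w. (Z l t w)\<^sup>2 \<partial>M) \<le> \<bar>cov_op l g 0\<bar> * (1 + \<bar>t\<bar>) ^ 2" for t
  proof -
    have "1 \<le> (1 + \<bar>t\<bar>) ^ 2" by simp
    from mult_left_mono[OF this, of "\<bar>cov_op l g 0\<bar>"]
    show ?thesis using Z_cov[OF l, of t t] by (simp add: power2_eq_square)
  qed
  then show "\<exists>D. \<forall>t. (\<integral>w. (Z l t w)\<^sup>2 \<partial>M) \<le> D * (1 + \<bar>t\<bar>) ^ 2" by blast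
qed

end

section \<open>Decay of the covariance\<close>

text \<open>A non-integrable function has Bochner integral 0 by convention, so a majorant alone
  bounds the integral. This lets \<open>cov_op\<close> be estimated for functions known only through
  a pointwise bound.\<close>

lemma abs_integral_le:
  fixes f b :: "'a \<Rightarrow> real"
  assumes b: "integrable M b" and le: "AE x in M. \<bar>f x\<bar> \<le> b x"
  shows "\<bar>\<integral>x. f x \<partial>M\<bar> \<le> (\<integral>x. b x \<partial>M)"
proof (cases "integrable M f")
  case True
  have "\<bar>\<integral>x. f x \<partial>M\<bar> \<le> (\<integral>x. \<bar>f x\<bar> \<partial>M)" by simp
  also have "\<dots> \<le> (\<integral>x. b x \<partial>M)" using True b le by (intro integral_mono_AE) auto
  finally show ?thesis .
next
  case False
  have "0 \<le> (\<integral>x. b x \<partial>M)"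
    using le by (intro integral_nonneg_AE) (auto elim!: eventually_mono)
  then show ?thesis using False by (simp add: not_integrable_integral_eq)
qed

lemma abs_cov_op_le:
  assumes l: "0 < l"
    and le: "\<And>u v. 0 \<le> u \<Longrightarrow> 0 \<le> v \<Longrightarrow> \<bar>mixed_diff u v g h\<bar> \<le> K * (1 + \<bar>u\<bar>) ^ k * (1 + \<bar>v\<bar>) ^ k"
  shows "\<bar>cov_op l g h\<bar> \<le> K * (\<integral>u. (1 + \<bar>u\<bar>) ^ k \<partial>expm l)\<^sup>2"
proof -
  let ?m = "\<integral>u. (1 + \<bar>u\<bar>) ^ k \<partial>expm l"
  note int = integrable_expm_power[OF l, of k]
  have "\<bar>\<integral>u. mixed_diff u v g h \<partial>expm l\<bar> \<le> K * ?m * (1 + \<bar>v\<bar>) ^ k" if "0 \<le> v" for v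
  proof -
    have "\<bar>\<integral>u. mixed_diff u v g h \<partial>expm l\<bar> \<le> (\<integral>u. K * (1 + \<bar>u\<bar>) ^ k * (1 + \<bar>v\<bar>) ^ k \<partial>expm l)"
      using int AE_expm_nonneg[of l] le that
      by (intro abs_integral_le integrable_mult_left integrable_mult_right) (auto elim!: eventually_mono)
    then show ?thesis using int by simp
  qed
  then have "\<bar>cov_op l g h\<bar> \<le> (\<integral>v. K * ?m * (1 + \<bar>v\<bar>) ^ k \<partial>expm l)"
    unfolding cov_op_def using int AE_expm_nonneg[of l]
    by (intro abs_integral_le integrable_mult_right) (auto elim!: eventually_mono)
  also have "\<dots> = K * ?m\<^sup>2" by (simp add: power2_eq_square)
  finally show ?thesis .
qed

lemma tame_reflect: "tame y \<Longrightarrow> tame (\<lambda>t. y (- t))"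
  unfolding tame_def
  by (auto intro!: continuous_on_compose2[of UNIV y UNIV uminus] continuous_intros)
     (metis abs_minus_cancel)

lemma integral_mixed_diff:
  assumes g: "tame g" and l: "0 < l"
  shows "integrable (expm l) (\<lambda>u. mixed_diff u v g x)"
    and "(\<integral>u. mixed_diff u v g x \<partial>expm l) = exp_diff l g x - exp_diff l g (x + v)"
    and "integrable (expm l) (\<lambda>v. \<integral>u. mixed_diff u v g x \<partial>expm l)"
proof -
  interpret E: prob_space "expm l" by (rule prob_space_expm[OF l])
  have eq: "(\<lambda>u. mixed_diff u v g x) = (\<lambda>u. (g x - g (x - u)) - (g (x + v) - g (x + v - u)))" for v
    by (auto simp: mixed_diff_def algebra_simps)
  have int: "integrable (expm l) (\<lambda>u. g t - g (t - u))" for t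
    by (intro Bochner_Integration.integrable_diff tame_integrable_shift(1)[OF g l] E.integrable_const)
  show "integrable (expm l) (\<lambda>u. mixed_diff u v g x)"
    unfolding eq by (intro Bochner_Integration.integrable_diff[OF int int])
  show *: "(\<integral>u. mixed_diff u v g x \<partial>expm l) = exp_diff l g x - exp_diff l g (x + v)" for v
    unfolding eq exp_diff_def by (rule Bochner_Integration.integral_diff[OF int int])
  show "integrable (expm l) (\<lambda>v. \<integral>u. mixed_diff u v g x \<partial>expm l)"
    unfolding *
    \<comment> \<open>The forward shift \<open>x + v\<close> is a backward shift of the reflected
      function, started at \<open>- x\<close>.\<close>
    using tame_integrable_shift(1)[OF tame_reflect[OF tame_exp_diff[OF g l]] l, of "- x"]
    by (simp add: add.commute)
qed

text \<open>Differencing commutes with averaging by linearity, once all iterated integrals are known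
  to exist. It puts the second differencing under the integrals of the first, where the cancellation
  is still visible.\<close>

lemma mixed_diff_cov_op:
  assumes g: "tame g" and l: "0 < l"
  shows "mixed_diff u' v' (cov_op l g) h
    = (\<integral>v. \<integral>u. mixed_diff u' v' (mixed_diff u v g) h \<partial>expm l \<partial>expm l)"
proof -
  note int1 = integral_mixed_diff(1)[OF g l] and int2 = integral_mixed_diff(3)[OF g l]
  show ?thesis
    unfolding cov_op_def mixed_diff_def[of u' v']
    by (simp add: int1 int2)
qed

section \<open>Fourth differences of powers\<close>

lemma mvt_le:
  fixes f f' :: "real \<Rightarrow> real"
  assumes "a \<le> b" and "\<And>x. a \<le> x \<Longrightarrow> x \<le> b \<Longrightarrow> (f has_real_derivative f' x) (at x)"
  obtains z where "a \<le> z" "z \<le> b" "f b - f a = (b - a) * f' z"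
proof (cases "a = b")
  case False
  then show ?thesis using MVT2[of a b f f'] assms that by (auto simp: less_le)
qed (use that in auto)

text \<open>Up to sign, a mixed difference is an increment over \<open>v\<close> of an increment
  over \<open>u\<close>. The mean value theorem is applied to \<open>f x - f (x - u)\<close> over
  the step \<open>v\<close>, then to \<open>f'\<close> over the step \<open>u\<close>.\<close>

lemma mixed_diff_mvt:
  fixes f f' f'' :: "real \<Rightarrow> real"
  assumes "0 \<le> u" "0 \<le> v"
    and f: "\<And>x. h - u \<le> x \<Longrightarrow> (f has_real_derivative f' x) (at x)"
    and f': "\<And>x. h - u \<le> x \<Longrightarrow> (f' has_real_derivative f'' x) (at x)"
  obtains z where "h - u \<le> z" "mixed_diff u v f h = - (u * v * f'' z)"
proof -
  have "((\<lambda>x. f x - f (x - u)) has_real_derivative f' x - f' (x - u)) (at x)" if "h \<le> x" for x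
    using f[of x] f[of "x - u"] that \<open>0 \<le> u\<close> DERIV_shift[of f "f' (x - u)" x "- u"]
    by (intro DERIV_diff) auto
  then obtain y where y: "h \<le> y"
    "(f (h + v) - f (h + v - u)) - (f h - f (h - u)) = (h + v - h) * (f' y - f' (y - u))"
    using mvt_le[of h "h + v" "\<lambda>x. f x - f (x - u)" "\<lambda>x. f' x - f' (x - u)"] \<open>0 \<le> v\<close> by auto
  obtain z where z: "y - u \<le> z" "f' y - f' (y - u) = (y - (y - u)) * f'' z"
    using mvt_le[of "y - u" y f' f''] f' y(1) \<open>0 \<le> u\<close> by auto
  show thesis
  proof (rule that)
    show "h - u \<le> z" using y(1) z(1) by simp
    show "mixed_diff u v f h = - (u * v * f'' z)"
      using y(2) unfolding z(2) by (simp add: mixed_diff_def algebra_simps)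
  qed
qed

lemma has_real_derivative_mixed_diff:
  assumes f: "\<And>y. c < y \<Longrightarrow> (f has_real_derivative f' y) (at y)"
    and "c < x - u" "0 \<le> u" "0 \<le> v"
  shows "(mixed_diff u v f has_real_derivative mixed_diff u v f' x) (at x)"
proof -
  have shift: "((\<lambda>x. f (x + d)) has_real_derivative f' (x + d)) (at x)" if "- u \<le> d" for d
    using f[of "x + d"] that assms(2) by (simp add: DERIV_shift)
  have "((\<lambda>x. f (x + 0) - f (x + - u) - f (x + v) + f (x + (v - u))) has_real_derivative
      f' (x + 0) - f' (x + - u) - f' (x + v) + f' (x + (v - u))) (at x)"
    using assms(3,4) by (intro DERIV_add DERIV_diff shift) auto
  moreover have "(\<lambda>x. f (x + 0) - f (x + - u) - f (x + v) + f (x + (v - u))) = mixed_diff u v f"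
    by (auto simp: mixed_diff_def algebra_simps)
  ultimately show ?thesis by (simp add: mixed_diff_def algebra_simps)
qed

lemma abs_mixed_diff_le:
  assumes "0 \<le> u" "0 \<le> v" and "\<And>x. \<bar>x - h\<bar> \<le> u + v \<Longrightarrow> \<bar>f x\<bar> \<le> B"
  shows "\<bar>mixed_diff u v f h\<bar> \<le> 4 * B"
proof -
  have "\<bar>f h\<bar> \<le> B" "\<bar>f (h - u)\<bar> \<le> B" "\<bar>f (h + v)\<bar> \<le> B" "\<bar>f (h - u + v)\<bar> \<le> B"
    using assms(1,2) by (auto intro!: assms(3))
  then show ?thesis unfolding mixed_diff_def by linarith
qed

lemma abs_powr_le_square:
  assumes "0 \<le> p" "p \<le> 2"
  shows "\<bar>x\<bar> powr p \<le> (1 + \<bar>x::real\<bar>) ^ 2"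
proof -
  have "\<bar>x\<bar> powr p \<le> (1 + \<bar>x\<bar>) powr p" using assms by (intro powr_mono2) auto
  also have "\<dots> \<le> (1 + \<bar>x\<bar>) powr 2" using assms by (intro powr_mono) auto
  finally show ?thesis by (simp add: powr_numeral)
qed

lemma tame_abs_powr:
  assumes "0 < p" "p \<le> 2"
  shows "tame (\<lambda>x. c * \<bar>x\<bar> powr p)"
  unfolding tame_def
proof (intro conjI exI allI)
  show "continuous_on UNIV (\<lambda>x. c * \<bar>x\<bar> powr p)"
    using assms by (intro continuous_intros continuous_on_powr') auto
  show "\<bar>c * \<bar>x\<bar> powr p\<bar> \<le> \<bar>c\<bar> * (1 + \<bar>x\<bar>) ^ 2" for x
    using assms abs_powr_le_square[of p x] by (simp add: abs_mult mult_left_mono)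
qed

text \<open>Two mixed differences become a fourth derivative at some
  \<open>z \<ge> h - u - u' \<ge> h / 2\<close>. Its coefficient is at most 4 in absolute value, and
  \<open>1 + h\<^sup>2 \<le> 5 * z\<^sup>2\<close>, whence 20.\<close>

lemma fourth_diff_far:
  assumes p: "1 \<le> p" "p \<le> 2"
    and nn: "0 \<le> u" "0 \<le> v" "0 \<le> u'" "0 \<le> v'"
    and far: "2 \<le> h" "u + u' \<le> h / 2"
  shows "\<bar>mixed_diff u' v' (mixed_diff u v (\<lambda>x. \<bar>x\<bar> powr p)) h\<bar> \<le> 20 * (u * v * u' * v') / (1 + h\<^sup>2)"
proof -
  \<comment> \<open>On the positive axis \<open>f k\<close> is the \<open>k\<close>-th derivative of
    \<open>x powr p\<close>.\<close>
  define f where "f k x = (\<Prod>i<k. p - real i) * x powr (p - real k)" for k x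
  have f: "(f k has_real_derivative f (Suc k) x) (at x)" if "0 < x" for k x
  proof -
    have "p - real k - 1 = p - real (Suc k)" by simp
    with DERIV_cmult[OF has_real_derivative_powr[OF that, of "p - real k"], of "\<Prod>i<k. p - real i"]
    show ?thesis unfolding f_def by (simp only: prod.lessThan_Suc mult.assoc)
  qed
  have "mixed_diff u' v' (mixed_diff u v (\<lambda>x. \<bar>x\<bar> powr p)) h = mixed_diff u' v' (mixed_diff u v (f 0)) h"
    using nn far by (simp add: mixed_diff_def f_def)
  moreover obtain z' where z': "h - u' \<le> z'"
    "mixed_diff u' v' (mixed_diff u v (f 0)) h = - (u' * v' * mixed_diff u v (f 2) z')"
  proof (rule mixed_diff_mvt[OF nn(3,4), of h "mixed_diff u v (f 0)" "mixed_diff u v (f 1)" "mixed_diff u v (f 2)"])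
    fix x assume "h - u' \<le> x"
    then have "0 < x - u" using far by simp
    then have "(mixed_diff u v (f k) has_real_derivative mixed_diff u v (f (Suc k)) x) (at x)" for k
      using f nn(1,2) by (intro has_real_derivative_mixed_diff[where c = 0])
    from this[of 0] this[of 1]
    show "(mixed_diff u v (f 0) has_real_derivative mixed_diff u v (f 1) x) (at x)"
      and "(mixed_diff u v (f 1) has_real_derivative mixed_diff u v (f 2) x) (at x)"
      by (simp_all add: numeral_2_eq_2)
  qed
  moreover obtain z where z: "z' - u \<le> z" "mixed_diff u v (f 2) z' = - (u * v * f 4 z)"
  proof (rule mixed_diff_mvt[OF nn(1,2), of z' "f 2" "f 3" "f 4"])
    fix x assume "z' - u \<le> x"
    then have "0 < x" using far z'(1) by simp
    then show "(f 2 has_real_derivative f 3 x) (at x)" "(f 3 has_real_derivative f 4 x) (at x)"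
      using f[of x 2] f[of x 3] by simp_all
  qed
  ultimately have eq: "\<bar>mixed_diff u' v' (mixed_diff u v (\<lambda>x. \<bar>x\<bar> powr p)) h\<bar> = (u * v * u' * v') * \<bar>f 4 z\<bar>"
    using nn by (simp add: abs_mult)
  have zh: "h / 2 \<le> z" using far z'(1) z(1) by simp
  then have "1 \<le> z" using far by simp
  have "\<bar>p * (p - 1) * (p - 2) * (p - 3)\<bar> \<le> 2 * 1 * 1 * 2"
    unfolding abs_mult using p by (intro mult_mono) auto
  moreover have "z powr (p - 4) \<le> 1 / z\<^sup>2"
  proof -
    have "z powr (p - 4) \<le> z powr (- 2)" using \<open>1 \<le> z\<close> p by (intro powr_mono) auto
    also have "\<dots> = 1 / z\<^sup>2" using \<open>1 \<le> z\<close> by (simp add: powr_minus powr_numeral divide_inverse)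
    finally show ?thesis .
  qed
  ultimately have "\<bar>p * (p - 1) * (p - 2) * (p - 3)\<bar> * z powr (p - 4) \<le> 4 * (1 / z\<^sup>2)"
    by (intro mult_mono) auto
  moreover have "f 4 z = p * (p - 1) * (p - 2) * (p - 3) * z powr (p - 4)"
    by (simp add: f_def numeral_eq_Suc)
  ultimately have "\<bar>f 4 z\<bar> \<le> 4 * (1 / z\<^sup>2)" by (simp add: abs_mult)
  also have "\<dots> \<le> 20 / (1 + h\<^sup>2)"
  proof -
    have "(h / 2)\<^sup>2 \<le> z\<^sup>2" using zh far by (intro power_mono) auto
    moreover have "2 * 2 \<le> h * h" using far by (intro mult_mono) auto
    ultimately have "1 + h\<^sup>2 \<le> 5 * z\<^sup>2" by (simp add: power2_eq_square)
    moreover have "0 < z\<^sup>2" "0 < 1 + h\<^sup>2" using \<open>1 \<le> z\<close> by (auto simp: add_pos_nonneg)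
    ultimately show ?thesis by (simp add: field_simps)
  qed
  finally have "(u * v * u' * v') * \<bar>f 4 z\<bar> \<le> (u * v * u' * v') * (20 / (1 + h\<^sup>2))"
    using nn by (intro mult_left_mono) auto
  then show ?thesis unfolding eq by (simp add: mult.commute)
qed

text \<open>Here the steps dominate \<open>h\<close>. Each of the 16 nodes \<open>y\<close>
  satisfies \<open>1 + \<bar>y\<bar> \<le> 3 * ?S\<close>, and also
  \<open>1 + h\<^sup>2 \<le> (3 * ?S)\<^sup>2\<close>, so multiplying by
  \<open>1 + h\<^sup>2\<close> costs only a power of the steps;
  \<open>1296 = 16 * 9 * 9\<close>.\<close>

lemma fourth_diff_near:
  assumes p: "1 \<le> p" "p \<le> 2"
    and nn: "0 \<le> u" "0 \<le> v" "0 \<le> u'" "0 \<le> v'"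
    and near: "\<bar>h\<bar> \<le> 2 + 2 * (u + v + u' + v')"
  shows "\<bar>mixed_diff u' v' (mixed_diff u v (\<lambda>x. \<bar>x\<bar> powr p)) h\<bar>
    \<le> 1296 * (1 + u + v + u' + v') ^ 4 / (1 + h\<^sup>2)"
proof -
  let ?S = "1 + u + v + u' + v'"
  have "\<bar>mixed_diff u' v' (mixed_diff u v (\<lambda>x. \<bar>x\<bar> powr p)) h\<bar> \<le> 4 * (4 * (3 * ?S)\<^sup>2)"
  proof (intro abs_mixed_diff_le nn)
    fix x y assume "\<bar>x - h\<bar> \<le> u' + v'" "\<bar>y - x\<bar> \<le> u + v"
    then have "1 + \<bar>y\<bar> \<le> 3 * ?S" using near by argo
    then have "(1 + \<bar>y\<bar>) ^ 2 \<le> (3 * ?S)\<^sup>2" by (intro power_mono) auto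
    then show "\<bar>\<bar>y\<bar> powr p\<bar> \<le> (3 * ?S)\<^sup>2" using abs_powr_le_square[of p y] p by simp
  qed
  moreover have h: "1 + h\<^sup>2 \<le> (3 * ?S)\<^sup>2"
  proof -
    have "1 + h\<^sup>2 \<le> (1 + \<bar>h\<bar>)\<^sup>2" by (simp add: power2_sum)
    also have "\<dots> \<le> (3 * ?S)\<^sup>2" using near nn by (intro power_mono) auto
    finally show ?thesis .
  qed
  ultimately have "\<bar>mixed_diff u' v' (mixed_diff u v (\<lambda>x. \<bar>x\<bar> powr p)) h\<bar> * (1 + h\<^sup>2)
      \<le> 4 * (4 * (3 * ?S)\<^sup>2) * (3 * ?S)\<^sup>2"
    by (intro mult_mono) auto
  also have "\<dots> = 1296 * ?S ^ 4"
  proof -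
    have "4 * (4 * (3 * s)\<^sup>2) * (3 * s)\<^sup>2 = 1296 * s ^ 4" for s :: real
      by (simp add: power2_eq_square power4_eq_xxxx)
    then show ?thesis .
  qed
  finally show ?thesis by (subst pos_le_divide_eq) (auto simp: add_pos_nonneg)
qed

text \<open>The sum of the steps is enlarged to a product so that the four variables can be
  integrated separately. Beyond the near range, \<open>\<bar>h\<bar> \<ge> 2\<close> and the steps
  add up to at most \<open>\<bar>h\<bar> / 2\<close>.\<close>

lemma fourth_diff_le:
  assumes p: "1 \<le> p" "p \<le> 2" and nn: "0 \<le> u" "0 \<le> v" "0 \<le> u'" "0 \<le> v'"
  shows "\<bar>mixed_diff u' v' (mixed_diff u v (\<lambda>x. \<bar>x\<bar> powr p)) h\<bar>
    \<le> 1296 * ((1 + u) * (1 + v) * (1 + u') * (1 + v')) ^ 4 / (1 + h\<^sup>2)"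
proof -
  let ?W = "(1 + u) * (1 + v) * (1 + u') * (1 + v')"
  have S: "1 + u + v + u' + v' \<le> ?W"
  proof -
    have "1 + u + v \<le> (1 + u) * (1 + v)" using nn by (simp add: algebra_simps)
    moreover have "(1 + u + v) + u' \<le> (1 + u + v) * (1 + u')" using nn by (simp add: algebra_simps)
    moreover have "(1 + u + v + u') + v' \<le> (1 + u + v + u') * (1 + v')" using nn by (simp add: algebra_simps)
    ultimately show ?thesis
      using nn by (meson add_nonneg_nonneg mult_right_mono order_trans zero_le_one)
  qed
  have W1: "1 \<le> ?W" using S nn by simp
  have le4: "(1 + u + v + u' + v') ^ 4 \<le> ?W ^ 4" using S nn by (intro power_mono) auto
  consider "\<bar>h\<bar> \<le> 2 + 2 * (u + v + u' + v')" | "2 + 2 * (u + v + u' + v') < h"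
    | "2 + 2 * (u + v + u' + v') < - h" by argo
  then show ?thesis
  proof cases
    case 1
    show ?thesis
      using fourth_diff_near[OF p nn 1] divide_right_mono[OF mult_left_mono[OF le4, of 1296], of "1 + h\<^sup>2"]
      by simp
  next
    have "u * v * u' * v' \<le> ?W" using nn by (intro mult_mono) auto
    also have "\<dots> \<le> ?W ^ 4" using self_le_power[OF W1, of 4] by simp
    finally have "20 * (u * v * u' * v') / (1 + h\<^sup>2) \<le> 1296 * ?W ^ 4 / (1 + h\<^sup>2)"
      using W1 nn by (intro divide_right_mono mult_mono) auto
    note far = order_trans[OF _ this]
    {
      case 2
      then show ?thesis using nn by (intro far fourth_diff_far p) auto
    next
      case 3
      \<comment> \<open>The power is even, and reflection exchanges backward and forward
        steps.\<close>
      have "mixed_diff u' v' (mixed_diff u v (\<lambda>x. \<bar>x\<bar> powr p)) h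
          = mixed_diff v' u' (mixed_diff v u (\<lambda>x. \<bar>x\<bar> powr p)) (- h)"
      proof -
        have even: "\<bar>- x - y\<bar> = \<bar>x + y\<bar>" for x y :: real by simp
        show ?thesis
          unfolding mixed_diff_def
          by (simp add: algebra_simps abs_minus_commute even)
      qed
      then show ?thesis
        using 3 nn fourth_diff_far[OF p nn(2,1,4,3), of "- h"] by (intro far) (auto simp: mult_ac)
    }
  qed
qed

section \<open>Quadratic decay and its stability\<close>

text \<open>This rate replaces the sharper \<open>h^(2H-4)\<close>: it is uniform in
  \<open>H\<close>, has no singularity at 0, is summable over the integers, and changes under shifts
  only by a polynomial factor.\<close>

definition quad_decay :: "(real \<Rightarrow> real) \<Rightarrow> bool" where
  "quad_decay g \<longleftrightarrow> (\<exists>C. \<forall>h. \<bar>g h\<bar> \<le> C / (1 + h\<^sup>2))"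

text \<open>The two applications are treated jointly because a single one decays only like
  \<open>h^(p-2)\<close> when \<open>p > 1\<close>. Each of the four averages contributes a fourth
  moment.\<close>

lemma quad_decay_cov_op_cov_op:
  assumes p: "1 \<le> p" "p \<le> 2" and l: "0 < a" "0 < b"
  shows "quad_decay (cov_op a (cov_op b (\<lambda>x. c * \<bar>x\<bar> powr p)))"
proof -
  let ?R = "\<lambda>x::real. \<bar>x\<bar> powr p" and ?g = "\<lambda>x. c * \<bar>x\<bar> powr p"
  let ?m = "\<lambda>l. (\<integral>u. (1 + \<bar>u\<bar>) ^ 4 \<partial>expm l)\<^sup>2"
  have g: "tame ?g" using p by (intro tame_abs_powr) auto
  define K where "K h = \<bar>c\<bar> * (1296 / (1 + h\<^sup>2))" for h :: real
  have "\<bar>cov_op a (cov_op b ?g) h\<bar> \<le> K h * ?m b * ?m a" for h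
  proof (rule abs_cov_op_le[OF l(1)])
    fix u' v' :: real assume nn': "0 \<le> u'" "0 \<le> v'"
    let ?G = "\<lambda>v u. mixed_diff u' v' (mixed_diff u v ?g) h"
    let ?K' = "K h * (1 + \<bar>u'\<bar>) ^ 4 * (1 + \<bar>v'\<bar>) ^ 4"
    note int = integrable_expm_power[OF l(2), of 4]
    have le: "\<bar>?G v u\<bar> \<le> ?K' * (1 + \<bar>u\<bar>) ^ 4 * (1 + \<bar>v\<bar>) ^ 4" if nn: "0 \<le> u" "0 \<le> v" for u v
    proof -
      have "?G v u = c * mixed_diff u' v' (mixed_diff u v ?R) h"
        by (simp add: mixed_diff_def algebra_simps)
      then show ?thesis
        using mult_left_mono[OF fourth_diff_le[OF p nn nn', of h] abs_ge_zero[of c]] nn nn'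
        by (simp add: abs_mult K_def power_mult_distrib mult_ac)
    qed
    have "\<bar>\<integral>u. ?G v u \<partial>expm b\<bar> \<le> ?K' * (\<integral>u. (1 + \<bar>u\<bar>) ^ 4 \<partial>expm b) * (1 + \<bar>v\<bar>) ^ 4" if "0 \<le> v" for v
    proof -
      have "\<bar>\<integral>u. ?G v u \<partial>expm b\<bar> \<le> (\<integral>u. ?K' * (1 + \<bar>u\<bar>) ^ 4 * (1 + \<bar>v\<bar>) ^ 4 \<partial>expm b)"
        using int AE_expm_nonneg[of b] le that
        by (intro abs_integral_le integrable_mult_left integrable_mult_right) (auto elim!: eventually_mono)
      then show ?thesis using int by simp
    qed
    then have "\<bar>mixed_diff u' v' (cov_op b ?g) h\<bar>
        \<le> (\<integral>v. ?K' * (\<integral>u. (1 + \<bar>u\<bar>) ^ 4 \<partial>expm b) * (1 + \<bar>v\<bar>) ^ 4 \<partial>expm b)"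
      unfolding mixed_diff_cov_op[OF g l(2)] using int AE_expm_nonneg[of b]
      by (intro abs_integral_le integrable_mult_right) (auto elim!: eventually_mono)
    then show "\<bar>mixed_diff u' v' (cov_op b ?g) h\<bar> \<le> K h * ?m b * (1 + \<bar>u'\<bar>) ^ 4 * (1 + \<bar>v'\<bar>) ^ 4"
      by (simp add: power2_eq_square mult_ac)
  qed
  then have "\<bar>cov_op a (cov_op b ?g) h\<bar> \<le> (\<bar>c\<bar> * 1296 * ?m b * ?m a) / (1 + h\<^sup>2)" for h
    by (simp add: K_def)
  then show ?thesis unfolding quad_decay_def by blast
qed

text \<open>A form of Peetre's inequality, from
  \<open>h\<^sup>2 \<le> 2 * (h + x)\<^sup>2 + 2 * x\<^sup>2\<close>.\<close>

lemma inverse_quadratic_shift_le: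
  "1 / (1 + (h + x)\<^sup>2) \<le> 2 * (1 + \<bar>x\<bar>) ^ 2 / (1 + (h::real)\<^sup>2)"
proof -
  have "h\<^sup>2 \<le> 2 * (h + x)\<^sup>2 + 2 * x\<^sup>2" using diff_square_le[of "h + x" x] by simp
  moreover have "2 * (1 + x\<^sup>2) * (1 + (h + x)\<^sup>2)
      = 2 + 2 * x\<^sup>2 + 2 * (h + x)\<^sup>2 + 2 * (x\<^sup>2 * (h + x)\<^sup>2)"
    by (simp add: distrib_left distrib_right)
  moreover have "0 \<le> x\<^sup>2 * (h + x)\<^sup>2" by simp
  ultimately have "1 + h\<^sup>2 \<le> 2 * (1 + x\<^sup>2) * (1 + (h + x)\<^sup>2)" by linarith
  also have "\<dots> \<le> 2 * (1 + \<bar>x\<bar>) ^ 2 * (1 + (h + x)\<^sup>2)"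
  proof (intro mult_right_mono mult_left_mono)
    show "1 + x\<^sup>2 \<le> (1 + \<bar>x\<bar>) ^ 2" by (simp add: power2_sum)
    show "0 \<le> 1 + (h + x)\<^sup>2" by (intro add_nonneg_nonneg) simp_all
  qed simp
  finally show ?thesis by (simp add: divide_simps add_pos_nonneg mult.commute)
qed

text \<open>No cancellation is used: each of the four nodes is a shift of \<open>h\<close>, and the
  shift costs a factor 2 and a polynomial weight, whence \<open>8 * C\<close>.\<close>

lemma quad_decay_cov_op:
  assumes l: "0 < l" and g: "quad_decay g"
  shows "quad_decay (cov_op l g)"
proof -
  obtain C where C: "\<And>h. \<bar>g h\<bar> \<le> C / (1 + h\<^sup>2)" using g unfolding quad_decay_def by auto
  have "0 \<le> C" using order_trans[OF abs_ge_zero C[of 0]] by simp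
  have "\<bar>cov_op l g h\<bar> \<le> (8 * C / (1 + h\<^sup>2)) * (\<integral>u. (1 + \<bar>u\<bar>) ^ 2 \<partial>expm l)\<^sup>2" for h
  proof (rule abs_cov_op_le[OF l])
    fix u v :: real assume nn: "0 \<le> u" "0 \<le> v"
    let ?B = "2 * C / (1 + h\<^sup>2) * ((1 + \<bar>u\<bar>) ^ 2 * (1 + \<bar>v\<bar>) ^ 2)"
    have B: "\<bar>g (h + x)\<bar> \<le> ?B" if x: "(1 + \<bar>x\<bar>) ^ 2 \<le> (1 + \<bar>u\<bar>) ^ 2 * (1 + \<bar>v\<bar>) ^ 2" for x
    proof -
      have "\<bar>g (h + x)\<bar> \<le> C * (2 * (1 + \<bar>x\<bar>) ^ 2 / (1 + h\<^sup>2))"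
        using order_trans[OF C[of "h + x"]] mult_left_mono[OF inverse_quadratic_shift_le[of h x] \<open>0 \<le> C\<close>]
        by simp
      also have "\<dots> = 2 * C / (1 + h\<^sup>2) * (1 + \<bar>x\<bar>) ^ 2" by simp
      also have "\<dots> \<le> ?B"
        using x \<open>0 \<le> C\<close> by (intro mult_left_mono) (auto intro!: divide_nonneg_nonneg)
      finally show ?thesis .
    qed
    have 1: "(1 + \<bar>v - u\<bar>) ^ 2 \<le> (1 + \<bar>u\<bar>) ^ 2 * (1 + \<bar>v\<bar>) ^ 2"
      using one_plus_abs_diff_power_le[of v u 2] by (simp add: mult.commute)
    have "1 \<le> (1 + \<bar>u\<bar>) ^ 2" "1 \<le> (1 + \<bar>v\<bar>) ^ 2" by simp_all
    then have 2: "1 * 1 \<le> (1 + \<bar>u\<bar>) ^ 2 * (1 + \<bar>v\<bar>) ^ 2"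
      "(1 + \<bar>u\<bar>) ^ 2 * 1 \<le> (1 + \<bar>u\<bar>) ^ 2 * (1 + \<bar>v\<bar>) ^ 2"
      "1 * (1 + \<bar>v\<bar>) ^ 2 \<le> (1 + \<bar>u\<bar>) ^ 2 * (1 + \<bar>v\<bar>) ^ 2"
      by (intro mult_mono; simp)+
    have "\<bar>g (h + 0)\<bar> \<le> ?B" "\<bar>g (h + - u)\<bar> \<le> ?B" "\<bar>g (h + v)\<bar> \<le> ?B" "\<bar>g (h + (v - u))\<bar> \<le> ?B"
      by (rule B; use 1 2 in simp)+
    moreover have "mixed_diff u v g h = g (h + 0) - g (h + - u) - g (h + v) + g (h + (v - u))"
      by (simp add: mixed_diff_def algebra_simps)
    ultimately have "\<bar>mixed_diff u v g h\<bar> \<le> 4 * ?B" by linarith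
    then show "\<bar>mixed_diff u v g h\<bar> \<le> 8 * C / (1 + h\<^sup>2) * (1 + \<bar>u\<bar>) ^ 2 * (1 + \<bar>v\<bar>) ^ 2" by simp
  qed
  then have "\<bar>cov_op l g h\<bar> \<le> (8 * C * (\<integral>u. (1 + \<bar>u\<bar>) ^ 2 \<partial>expm l)\<^sup>2) / (1 + h\<^sup>2)" for h by simp
  then show ?thesis unfolding quad_decay_def by blast
qed

lemma inverse_quadratic_summable_on_int: "(\<lambda>n::int. 1 / (1 + (real_of_int n)\<^sup>2)) summable_on UNIV"
proof -
  have "(\<lambda>n. 1 / (1 + (real n)\<^sup>2)) summable_on UNIV"
  proof (rule norm_summable_imp_summable_on)
    show "summable (\<lambda>n. norm (1 / (1 + (real n)\<^sup>2)))"
    proof (rule summable_comparison_test'[where N = 1])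
      show "summable (\<lambda>n. inverse (real n ^ 2))" by (rule inverse_power_summable) simp
      show "norm (norm (1 / (1 + (real n)\<^sup>2))) \<le> inverse (real n ^ 2)" if "1 \<le> n" for n
        using that by (auto simp: divide_simps add_pos_nonneg)
    qed
  qed
  then have "(\<lambda>n::int. 1 / (1 + (real_of_int n)\<^sup>2)) summable_on range int"
    and "(\<lambda>n::int. 1 / (1 + (real_of_int n)\<^sup>2)) summable_on range (\<lambda>n. - int n)"
    by (subst summable_on_reindex; simp add: inj_on_def o_def)+
  moreover have "(UNIV :: int set) = range int \<union> range (\<lambda>n. - int n)"
    by (auto simp: image_iff) (metis int_cases2)
  ultimately show ?thesis by (metis summable_on_union)
qed

text \<open>The sign matches the covariance at times 0 and \<open>n\<close>, which is
  \<open>g (0 - n)\<close>.\<close>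

lemma quad_decay_summable_on_int:
  assumes "quad_decay g"
  shows "(\<lambda>n::int. \<bar>g (- real_of_int n)\<bar>) summable_on UNIV"
proof -
  obtain C where C: "\<And>h. \<bar>g h\<bar> \<le> C / (1 + h\<^sup>2)" using assms unfolding quad_decay_def by auto
  show ?thesis
  proof (rule summable_on_comparison_test)
    show "(\<lambda>n::int. C * (1 / (1 + (real_of_int n)\<^sup>2))) summable_on UNIV"
      by (intro summable_on_cmult_right inverse_quadratic_summable_on_int)
    show "\<bar>g (- real_of_int n)\<bar> \<le> C * (1 / (1 + (real_of_int n)\<^sup>2))" for n :: int
      using C[of "- real_of_int n"] by simp
  qed auto
qed

section \<open>Growth of paths\<close>

text \<open>The index \<open>m div 2 ^ k\<close> is the unit interval containing the cell. Unit
  steps lead from 0 to the integer part of \<open>t\<close>, at most \<open>t\<close> steps of size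
  at most \<open>a * (1 + t)\<close>; this makes the bound quadratic. From there dyadic floors
  converge to \<open>t\<close>, with a geometric series of increments.\<close>

lemma growth_of_dyadic_increments:
  fixes y :: "real \<Rightarrow> real"
  assumes cont: "continuous_on UNIV y" and "0 \<le> a" and \<theta>: "0 < \<theta>" "\<theta> < 1"
    and inc: "\<And>k m. \<bar>y (real (Suc m) / 2 ^ k) - y (real m / 2 ^ k)\<bar> \<le> a * (1 + real (m div 2 ^ k)) * \<theta> ^ k"
  shows "\<exists>C. \<forall>t\<ge>0. \<bar>y t\<bar> \<le> C * (1 + t) ^ 2"
proof (intro exI allI impI)
  fix t :: real assume "0 \<le> t"
  define m where "m k = nat \<lfloor>2 ^ k * t\<rfloor>" for k
  have m_floor: "real (m k) = real_of_int \<lfloor>2 ^ k * t\<rfloor>" for k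
    using \<open>0 \<le> t\<close> by (simp add: m_def)
  have m_le: "real (m k) / 2 ^ k \<le> t" for k
    by (simp add: m_floor divide_le_eq mult.commute)
  let ?x = "\<lambda>k. real (m k) / 2 ^ k"
  have "isCont y t" using cont by (simp add: continuous_on_eq_continuous_at)
  moreover have "?x \<longlonglongrightarrow> t" unfolding m_floor by (rule dyadic_floor_tendsto)
  ultimately have lim: "(\<lambda>k. y (?x k)) \<longlonglongrightarrow> y t" by (rule isCont_tendsto_compose)
  have step: "\<bar>y (?x (Suc k)) - y (?x k)\<bar> \<le> a * (1 + t) * \<theta> ^ k" for k
  proof -
    have "m (Suc k) = 2 * m k \<or> m (Suc k) = Suc (2 * m k)"
    proof -
      define z where "z = 2 ^ k * t"
      have "\<lfloor>2 * z\<rfloor> = 2 * \<lfloor>z\<rfloor> \<or> \<lfloor>2 * z\<rfloor> = 2 * \<lfloor>z\<rfloor> + 1" by linarith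
      moreover have "0 \<le> \<lfloor>z\<rfloor>" using \<open>0 \<le> t\<close> by (simp add: z_def)
      ultimately show ?thesis by (auto simp: m_def z_def mult.assoc nat_mult_distrib nat_add_distrib)
    qed
    then show ?thesis
    proof
      assume "m (Suc k) = 2 * m k"
      then have "?x (Suc k) = ?x k" by simp
      then show ?thesis using \<open>0 \<le> a\<close> \<open>0 \<le> t\<close> \<theta> by simp
    next
      assume "m (Suc k) = Suc (2 * m k)"
      \<comment> \<open>Rewritten at level \<open>Suc k\<close>, the old floor is the left end of
        the cell that is crossed.\<close>
      moreover have "?x k = real (2 * m k) / 2 ^ Suc k" by simp
      ultimately have "\<bar>y (?x (Suc k)) - y (?x k)\<bar> \<le> a * (1 + real ((2 * m k) div 2 ^ Suc k)) * \<theta> ^ Suc k"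
        using inc[of "2 * m k" "Suc k"] by metis
      also have "\<dots> \<le> a * (1 + t) * \<theta> ^ k"
      proof (intro mult_mono mult_left_mono \<open>0 \<le> a\<close> add_left_mono)
        show "real ((2 * m k) div 2 ^ Suc k) \<le> t"
          using of_nat_div_le_of_nat[where 'a = real, of "2 * m k" "2 ^ Suc k"] m_le[of k] by simp
        show "\<theta> ^ Suc k \<le> \<theta> ^ k" using \<theta> by (intro power_decreasing) auto
      qed (use \<open>0 \<le> a\<close> \<open>0 \<le> t\<close> \<theta> in auto)
      finally show ?thesis .
    qed
  qed
  have "\<bar>y (?x k) - y (?x 0)\<bar> \<le> a * (1 + t) * (1 / (1 - \<theta>))" for k
  proof -
    have "\<bar>y (?x k) - y (?x 0)\<bar> = \<bar>\<Sum>j<k. y (?x (Suc j)) - y (?x j)\<bar>"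
      by (subst sum_lessThan_telescope) simp
    also have "\<dots> \<le> (\<Sum>j<k. a * (1 + t) * \<theta> ^ j)"
      by (intro order_trans[OF sum_abs] sum_mono step)
    also have "\<dots> = a * (1 + t) * (\<Sum>j<k. \<theta> ^ j)" by (simp add: sum_distrib_left)
    also have "\<dots> \<le> a * (1 + t) * (1 / (1 - \<theta>))"
    proof (rule mult_left_mono)
      have "(\<Sum>j<k. \<theta> ^ j) = (1 - \<theta> ^ k) / (1 - \<theta>)" using \<theta> by (simp add: sum_gp_strict)
      also have "\<dots> \<le> 1 / (1 - \<theta>)" using \<theta> by (intro divide_right_mono) auto
      finally show "(\<Sum>j<k. \<theta> ^ j) \<le> 1 / (1 - \<theta>)" .
    qed (use \<open>0 \<le> a\<close> \<open>0 \<le> t\<close> in simp)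
    finally show ?thesis .
  qed
  then have 1: "\<bar>y t - y (?x 0)\<bar> \<le> a * (1 + t) * (1 / (1 - \<theta>))"
    by (intro LIMSEQ_le_const2[OF tendsto_rabs[OF tendsto_diff[OF lim tendsto_const]]]) blast
  have "\<bar>y (real (m 0)) - y 0\<bar> = \<bar>\<Sum>j<m 0. y (real (Suc j)) - y (real j)\<bar>"
    by (subst sum_lessThan_telescope) simp
  also have "\<dots> \<le> (\<Sum>j<m 0. a * (1 + t))"
  proof (intro order_trans[OF sum_abs] sum_mono)
    fix j assume "j \<in> {..<m 0}"
    then have "a * (1 + real j) \<le> a * (1 + t)"
      using m_le[of 0] \<open>0 \<le> a\<close> by (intro mult_left_mono) auto
    then show "\<bar>y (real (Suc j)) - y (real j)\<bar> \<le> a * (1 + t)"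
      using inc[of j 0] by simp
  qed
  also have "\<dots> = real (m 0) * (a * (1 + t))" by simp
  also have "\<dots> \<le> (1 + t) * (a * (1 + t))"
    using m_le[of 0] \<open>0 \<le> a\<close> \<open>0 \<le> t\<close> by (intro mult_right_mono) auto
  finally have 2: "\<bar>y (real (m 0)) - y 0\<bar> \<le> a * (1 + t) ^ 2"
    by (simp add: power2_eq_square mult_ac)
  have t2: "1 + t \<le> (1 + t) ^ 2" "1 \<le> (1 + t) ^ 2"
    using \<open>0 \<le> t\<close> self_le_power[of "1 + t" 2] by auto
  have "a / (1 - \<theta>) * (1 + t) \<le> a / (1 - \<theta>) * (1 + t) ^ 2"
    using \<theta> \<open>0 \<le> a\<close> t2 by (intro mult_left_mono) auto
  moreover have "\<bar>y 0\<bar> * 1 \<le> \<bar>y 0\<bar> * (1 + t) ^ 2" using t2 by (intro mult_left_mono) auto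
  moreover have "a * (1 + t) * (1 / (1 - \<theta>)) = a / (1 - \<theta>) * (1 + t)" by simp
  moreover have "(a / (1 - \<theta>) + a + \<bar>y 0\<bar>) * (1 + t) ^ 2
      = a / (1 - \<theta>) * (1 + t) ^ 2 + a * (1 + t) ^ 2 + \<bar>y 0\<bar> * (1 + t) ^ 2" by (simp only: distrib_right)
  ultimately show "\<bar>y t\<bar> \<le> (a / (1 - \<theta>) + a + \<bar>y 0\<bar>) * (1 + t) ^ 2"
    using 1 2 by simp
qed

text \<open>Since \<open>p > 1\<close>, second moments suffice: the squared increments of level \<open>k\<close> in a unit interval
  add up to \<open>\<rho>\<^bsup>2k\<^esup>\<close> in the mean, so dividing by \<open>\<rho>\<^bsup>k\<^esup>\<close>, and by \<open>(1 + n)\<^sup>2\<close> on the \<open>n\<close>-th interval, keeps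
  the total summable.\<close>
lemma AE_dyadic_increments:
  fixes Y :: "real \<Rightarrow> 'a \<Rightarrow> real"
  assumes meas [measurable]: "\<And>t. Y t \<in> borel_measurable M"
    and int: "\<And>s t. integrable M (\<lambda>w. (Y s w - Y t w)\<^sup>2)"
    and inc: "\<And>s t. (\<integral>w. (Y s w - Y t w)\<^sup>2 \<partial>M) \<le> K * \<bar>s - t\<bar> powr p"
    and p: "1 < p" and \<rho>: "\<rho> = 2 powr ((1 - p) / 2)"
  shows "AE w in M. \<exists>c\<ge>0. \<forall>k m. (Y (real (Suc m) / 2 ^ k) w - Y (real m / 2 ^ k) w)\<^sup>2
    \<le> c * (1 + real (m div 2 ^ k))\<^sup>2 * \<rho> ^ k"
proof -
  have "2 powr ((1 - p) / 2) < 2 powr 0" using p by (intro powr_less_mono) auto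
  then have \<rho>01: "0 < \<rho>" "\<rho> < 1" by (simp_all add: \<rho>)
  have "0 \<le> (\<integral>w. (Y 1 w - Y 0 w)\<^sup>2 \<partial>M)" by simp
  also have "\<dots> \<le> K" using inc[of 1 0] by simp
  finally have "0 \<le> K" .
  define d where "d k m w = (Y (real (Suc m) / 2 ^ k) w - Y (real m / 2 ^ k) w)\<^sup>2" for k m w
  define f where "f n k w = (\<Sum>i<2 ^ k. d k (n * 2 ^ k + i) w) / ((1 + real n)\<^sup>2 * \<rho> ^ k)" for n k w
  have d_nonneg: "0 \<le> d k m w" for k m w by (simp add: d_def)
  have f_nonneg: "0 \<le> f n k w" for n k w
    unfolding f_def using \<rho>01 by (intro divide_nonneg_nonneg sum_nonneg d_nonneg) auto
  have d_int: "integrable M (d k m)" for k m unfolding d_def by (rule int)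
  have f_int: "integrable M (f n k)" for n k
    unfolding f_def by (intro Bochner_Integration.integrable_divide Bochner_Integration.integrable_sum d_int)
  note [measurable] = borel_measurable_integrable[OF f_int]
  \<comment> \<open>The choice of \<open>\<rho>\<close> gives
    \<open>\<rho>\<^sup>2 / 2 = 2 powr (- p)\<close>; the factor 1/2 per level pays for the doubling
    of the number of cells.\<close>
  have d_le: "(\<integral>w. d k m w \<partial>M) \<le> K * (\<rho>\<^sup>2 / 2) ^ k" for k m
  proof -
    have "real (Suc m) / 2 ^ k - real m / 2 ^ k = 2 powr (- real k)"
      by (simp add: powr_minus powr_realpow divide_inverse flip: left_diff_distrib)
    then have "\<bar>real (Suc m) / 2 ^ k - real m / 2 ^ k\<bar> powr p = 2 powr (- p * real k)"
      by (simp add: powr_powr mult.commute)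
    also have "- p * real k = (1 - p - 1) * real k" by simp
    also have "2 powr ((1 - p - 1) * real k) = (2 powr (1 - p - 1)) ^ k"
      by (subst powr_powr[symmetric]) (simp add: powr_realpow)
    also have "2 powr (1 - p - 1) = \<rho>\<^sup>2 / 2"
      by (simp add: powr_diff powr_minus_divide \<rho> power2_eq_square flip: powr_add)
    finally show ?thesis using inc[of "real (Suc m) / 2 ^ k" "real m / 2 ^ k"] by (simp add: d_def)
  qed
  have f_le: "(\<integral>w. f n k w \<partial>M) \<le> K / (1 + real n)\<^sup>2 * \<rho> ^ k" for n k
  proof -
    have "(\<integral>w. f n k w \<partial>M) = (\<Sum>i<2 ^ k. \<integral>w. d k (n * 2 ^ k + i) w \<partial>M) / ((1 + real n)\<^sup>2 * \<rho> ^ k)"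
      unfolding f_def using d_int by (simp add: Bochner_Integration.integral_sum)
    also have "\<dots> \<le> (\<Sum>i<(2::nat) ^ k. K * (\<rho>\<^sup>2 / 2) ^ k) / ((1 + real n)\<^sup>2 * \<rho> ^ k)"
      using \<rho>01 by (intro divide_right_mono sum_mono d_le) auto
    also have "(\<Sum>i<(2::nat) ^ k. K * (\<rho>\<^sup>2 / 2) ^ k) = K * (\<rho> ^ k * \<rho> ^ k)"
      by (simp add: power_divide power2_eq_square power_mult_distrib)
    also have "K * (\<rho> ^ k * \<rho> ^ k) / ((1 + real n)\<^sup>2 * \<rho> ^ k) = K / (1 + real n)\<^sup>2 * \<rho> ^ k"
      using \<rho>01 by simp
    finally show ?thesis .
  qed
  let ?S = "\<lambda>w. \<Sum>n. \<Sum>k. ennreal (f n k w)"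
  have "(\<integral>\<^sup>+w. ?S w \<partial>M) = (\<Sum>n. \<Sum>k. \<integral>\<^sup>+w. ennreal (f n k w) \<partial>M)"
    by (subst nn_integral_suminf, measurable) (subst nn_integral_suminf, measurable)
  also have "\<dots> = (\<Sum>n. \<Sum>k. ennreal (\<integral>w. f n k w \<partial>M))"
    by (subst nn_integral_eq_integral[OF f_int]) (simp_all add: f_nonneg)
  also have "\<dots> \<le> (\<Sum>n. \<Sum>k. ennreal (K / (1 + real n)\<^sup>2 * \<rho> ^ k))"
    by (intro suminf_le ennreal_leI f_le allI summableI)
  also have "\<dots> = (\<Sum>n. ennreal (K / (1 + real n)\<^sup>2 * (1 / (1 - \<rho>))))"
  proof (intro suminf_cong suminf_ennreal_eq)
    show "(\<lambda>k. K / (1 + real n)\<^sup>2 * \<rho> ^ k) sums (K / (1 + real n)\<^sup>2 * (1 / (1 - \<rho>)))" for n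
      using \<rho>01 by (intro sums_mult geometric_sums) auto
  qed (use \<open>0 \<le> K\<close> \<rho>01 in simp)
  also have "\<dots> = ennreal (\<Sum>n. K / (1 + real n)\<^sup>2 * (1 / (1 - \<rho>)))"
  proof (rule suminf_ennreal2)
    have "summable (\<lambda>n. inverse (real (Suc n) ^ 2))"
      by (subst summable_Suc_iff) (rule inverse_power_summable, simp)
    then show "summable (\<lambda>n. K / (1 + real n)\<^sup>2 * (1 / (1 - \<rho>)))"
      by (intro summable_mult2) (auto simp: divide_inverse intro: summable_mult)
  qed (use \<open>0 \<le> K\<close> \<rho>01 in simp)
  also have "\<dots> < \<infinity>" by simp
  finally have fin: "(\<integral>\<^sup>+w. ?S w \<partial>M) \<noteq> \<infinity>" by simp
  have "AE w in M. ?S w \<noteq> \<infinity>"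
    by (rule nn_integral_PInf_AE[OF _ fin]) measurable
  then show ?thesis
  proof eventually_elim
    case (elim w)
    \<comment> \<open>The random constant is the whole double sum; it is almost surely finite
      because its expectation is, and it dominates each of its nonnegative terms.\<close>
    define c where "c = enn2real (?S w)"
    have c: "?S w = ennreal c" using elim by (simp add: c_def less_top)
    have "0 \<le> c" by (simp add: c_def)
    have "d k m w \<le> c * (1 + real (m div 2 ^ k))\<^sup>2 * \<rho> ^ k" for k m
    proof -
      let ?n = "m div 2 ^ k"
      have "ennreal (f ?n k w) \<le> (\<Sum>k. ennreal (f ?n k w))"
        using sum_le_suminf[OF summableI, of "{k}" "\<lambda>k. ennreal (f ?n k w)"] by simp
      also have "\<dots> \<le> ?S w"
        using sum_le_suminf[OF summableI, of "{?n}" "\<lambda>n. \<Sum>k. ennreal (f n k w)"] by simp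
      finally have "f ?n k w \<le> c" using c \<open>0 \<le> c\<close> by simp
      then have "(\<Sum>i<2 ^ k. d k (?n * 2 ^ k + i) w) \<le> c * ((1 + real ?n)\<^sup>2 * \<rho> ^ k)"
        unfolding f_def using \<rho>01 by (subst (asm) pos_divide_le_eq) (auto intro!: mult_pos_pos)
      moreover have "d k (?n * 2 ^ k + m mod 2 ^ k) w \<le> (\<Sum>i<2 ^ k. d k (?n * 2 ^ k + i) w)"
        using d_nonneg by (intro member_le_sum) auto
      ultimately show ?thesis unfolding div_mult_mod_eq mult.assoc by linarith
    qed
    then show ?case using \<open>0 \<le> c\<close> unfolding d_def by blast
  qed
qed

lemma AE_quadratic_growth:
  fixes Y :: "real \<Rightarrow> 'a \<Rightarrow> real"
  assumes meas: "\<And>t. Y t \<in> borel_measurable M"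
    and int: "\<And>s t. integrable M (\<lambda>w. (Y s w - Y t w)\<^sup>2)"
    and inc: "\<And>s t. (\<integral>w. (Y s w - Y t w)\<^sup>2 \<partial>M) \<le> K * \<bar>s - t\<bar> powr p"
    and p: "1 < p"
    and cont: "AE w in M. continuous_on UNIV (\<lambda>t. Y t w)"
  shows "AE w in M. \<exists>C. \<forall>t\<ge>0. \<bar>Y t w\<bar> \<le> C * (1 + t) ^ 2"
proof -
  define \<rho> :: real where "\<rho> = 2 powr ((1 - p) / 2)"
  have "2 powr ((1 - p) / 2) < 2 powr 0" using p by (intro powr_less_mono) auto
  then have \<rho>01: "0 < \<rho>" "\<rho> < 1" by (simp_all add: \<rho>_def)
  show ?thesis
    using AE_dyadic_increments[OF meas int inc p \<rho>_def] cont
  proof eventually_elim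
    case (elim w)
    then obtain c where c: "0 \<le> c"
      "\<And>k m. (Y (real (Suc m) / 2 ^ k) w - Y (real m / 2 ^ k) w)\<^sup>2 \<le> c * (1 + real (m div 2 ^ k))\<^sup>2 * \<rho> ^ k"
      by blast
    show ?case
    \<comment> \<open>Square roots turn the weight \<open>(1 + n)\<^sup>2\<close> into the linear
      one required for chaining, and the ratio \<open>\<rho>\<close> into
      \<open>sqrt \<rho> < 1\<close>.\<close>
    proof (rule growth_of_dyadic_increments[where a = "sqrt c" and \<theta> = "sqrt \<rho>"])
      show "\<bar>Y (real (Suc m) / 2 ^ k) w - Y (real m / 2 ^ k) w\<bar>
          \<le> sqrt c * (1 + real (m div 2 ^ k)) * sqrt \<rho> ^ k" for k m
        using real_sqrt_le_mono[OF c(2)[of m k]]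
        unfolding real_sqrt_mult real_sqrt_abs unfolding real_sqrt_power by simp
    qed (use elim c \<rho>01 in auto)
  qed
qed

text \<open>Negative times are covered by the time-reversed process, whose increments obey the same
  moment bound.\<close>

lemma AE_tame:
  fixes Y :: "real \<Rightarrow> 'a \<Rightarrow> real"
  assumes meas: "\<And>t. Y t \<in> borel_measurable M"
    and int: "\<And>s t. integrable M (\<lambda>w. (Y s w - Y t w)\<^sup>2)"
    and inc: "\<And>s t. (\<integral>w. (Y s w - Y t w)\<^sup>2 \<partial>M) \<le> K * \<bar>s - t\<bar> powr p"
    and p: "1 < p"
    and cont: "AE w in M. continuous_on UNIV (\<lambda>t. Y t w)"
  shows "AE w in M. tame (\<lambda>t. Y t w)"
proof -
  have "AE w in M. continuous_on UNIV (\<lambda>t. Y (- t) w)"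
    using cont by eventually_elim (auto intro!: continuous_on_compose2[of UNIV _ UNIV uminus] continuous_intros)
  moreover have "(\<integral>w. (Y (- s) w - Y (- t) w)\<^sup>2 \<partial>M) \<le> K * \<bar>s - t\<bar> powr p" for s t
    using inc[of "- s" "- t"] by (simp add: abs_minus_commute)
  ultimately have "AE w in M. \<exists>C. \<forall>t\<ge>0. \<bar>Y (- t) w\<bar> \<le> C * (1 + t) ^ 2"
    by (intro AE_quadratic_growth[where Y = "\<lambda>t. Y (- t)", OF meas int _ p])
  with AE_quadratic_growth[OF assms] cont show ?thesis
  proof eventually_elim
    case (elim w)
    then obtain C C' where C: "\<And>t. 0 \<le> t \<Longrightarrow> \<bar>Y t w\<bar> \<le> C * (1 + t) ^ 2"
      and C': "\<And>t. 0 \<le> t \<Longrightarrow> \<bar>Y (- t) w\<bar> \<le> C' * (1 + t) ^ 2" by blast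
    have "\<bar>Y t w\<bar> \<le> max C C' * (1 + \<bar>t\<bar>) ^ 2" for t
    proof (cases "0 \<le> t")
      case True
      then show ?thesis using order_trans[OF C mult_right_mono[of C "max C C'"]] by simp
    next
      case False
      then show ?thesis using order_trans[OF C'[of "- t"] mult_right_mono[of C' "max C C'"]] by simp
    qed
    then show ?case using elim unfolding tame_def by blast
  qed
qed

section \<open>Short memory\<close>

lemma tame_cmult: "tame y \<Longrightarrow> tame (\<lambda>t. c * y t)"
proof (elim tameE)
  fix C assume "continuous_on UNIV y" and C: "\<And>t. \<bar>y t\<bar> \<le> C * (1 + \<bar>t\<bar>) ^ 2"
  then have "continuous_on UNIV (\<lambda>t. c * y t)" by (intro continuous_on_mult_left)
  moreover have "\<bar>c * y t\<bar> \<le> \<bar>c\<bar> * C * (1 + \<bar>t\<bar>) ^ 2" for t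
    using mult_left_mono[OF C abs_ge_zero[of c], of t] by (simp add: abs_mult mult.assoc)
  ultimately show "tame (\<lambda>t. c * y t)" unfolding tame_def by blast
qed

lemma tame_zero: "tame (\<lambda>_. 0)"
  unfolding tame_def by (auto intro: exI[of _ 0])

text \<open>The covariance formula of the definition does not by itself give integrability, since
  integrals default to 0; the Gaussian law supplies it.\<close>

lemma gaussian_rv_square_integrable:
  assumes "prob_space M" and Y: "gaussian_rv M Y"
  shows "integrable M (\<lambda>w. (Y w)\<^sup>2)"
proof -
  interpret prob_space M by fact
  obtain m s where s: "0 \<le> s" and meas [measurable]: "Y \<in> borel_measurable M"
    and Y': "if s = 0 then AE w in M. Y w = m
      else distributed M lborel Y (\<lambda>x. ennreal (normal_density m s x))"
    using Y unfolding gaussian_rv_def by blast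
  show ?thesis
  proof (cases "s = 0")
    case True
    then have "AE w in M. (Y w)\<^sup>2 = m\<^sup>2" using Y' by (auto elim!: eventually_mono)
    then have "integrable M (\<lambda>w. (Y w)\<^sup>2) \<longleftrightarrow> integrable M (\<lambda>_. m\<^sup>2)"
      by (intro integrable_cong_AE) auto
    then show ?thesis by simp
  next
    case False
    then have D: "distributed M lborel Y (\<lambda>x. ennreal (normal_density m s x))" and s0: "0 < s"
      using Y' s by auto
    \<comment> \<open>The expansion of \<open>x\<^sup>2\<close> about \<open>m\<close> reduces the
      claim to central moments.\<close>
    have "integrable lborel (\<lambda>x. normal_density m s x * (x - m) ^ 2
        + 2 * m * (normal_density m s x * (x - m) ^ 1) + m\<^sup>2 * normal_density m s x)"
      by (intro Bochner_Integration.integrable_add integrable_mult_right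
          integrable_normal_moment[OF s0] integrable_normal_density[OF s0])
    moreover have "(\<lambda>x. normal_density m s x * (x - m) ^ 2
        + 2 * m * (normal_density m s x * (x - m) ^ 1) + m\<^sup>2 * normal_density m s x)
        = (\<lambda>x. normal_density m s x * x\<^sup>2)"
      by (auto simp: power2_eq_square algebra_simps)
    ultimately show ?thesis
      using distributed_integrable[OF D, of "\<lambda>x. x\<^sup>2"] by simp
  qed
qed

lemma fractional_brownian_motionD:
  assumes M: "prob_space M" and B: "fractional_brownian_motion M H B"
  shows "B t \<in> borel_measurable M" and "integrable M (\<lambda>w. (B t w)\<^sup>2)"
    and "(\<integral>w. (B t w)\<^sup>2 \<partial>M) = \<bar>t\<bar> powr (2 * H)"
    and "integrable M (\<lambda>w. (B s w - B t w)\<^sup>2)"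
    and "(\<integral>w. (B s w - B t w)\<^sup>2 \<partial>M) = \<bar>s - t\<bar> powr (2 * H)"
proof -
  interpret prob_space M by fact
  have "gaussian_process M B" using B unfolding fractional_brownian_motion_def by blast
  from this[unfolded gaussian_process_def, rule_format, of "{t}" "\<lambda>_. 1" for t]
  have G: "gaussian_rv M (B t)" for t by simp
  show meas: "B t \<in> borel_measurable M" for t using G unfolding gaussian_rv_def by blast
  show sq: "integrable M (\<lambda>w. (B t w)\<^sup>2)" for t by (rule gaussian_rv_square_integrable[OF M G])
  have cov: "(\<integral>w. B t w * B s w \<partial>M) =
        (1/2) * (\<bar>t\<bar> powr (2 * H) + \<bar>s\<bar> powr (2 * H) - \<bar>t - s\<bar> powr (2 * H))" for t s
    using B unfolding fractional_brownian_motion_def by blast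
  show var: "(\<integral>w. (B t w)\<^sup>2 \<partial>M) = \<bar>t\<bar> powr (2 * H)" for t
    using cov[of t t] by (simp add: power2_eq_square)
  show "integrable M (\<lambda>w. (B s w - B t w)\<^sup>2)" by (rule integrable_diff_square[OF meas meas sq sq])
  have "(\<integral>w. (B s w - B t w)\<^sup>2 \<partial>M)
      = (\<integral>w. (B s w)\<^sup>2 + (B t w)\<^sup>2 - 2 * (B s w * B t w) \<partial>M)"
    by (intro Bochner_Integration.integral_cong) (auto simp: power2_diff)
  also have "\<dots> = (\<integral>w. (B s w)\<^sup>2 \<partial>M) + (\<integral>w. (B t w)\<^sup>2 \<partial>M) - 2 * (\<integral>w. B s w * B t w \<partial>M)"
    using sq integrable_mult_square[OF meas meas sq sq] by simp
  also have "\<dots> = \<bar>s - t\<bar> powr (2 * H)" unfolding var cov by (simp add: field_simps)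
  finally show "(\<integral>w. (B s w - B t w)\<^sup>2 \<partial>M) = \<bar>s - t\<bar> powr (2 * H)" .
qed

lemma foldr_OU_op_eq_exp_diff:
  assumes "tame y" "\<forall>a\<in>set ls. 0 < a"
  shows "foldr OU_op ls y = foldr exp_diff ls y" and "tame (foldr exp_diff ls y)"
  using assms(2)
proof (induction ls)
  case (Cons a ls)
  {
    case 1
    with Cons show ?case by (auto simp: OU_op_eq_exp_diff)
  next
    case 2
    with Cons show ?case by (auto intro: tame_exp_diff)
  }
qed (use assms(1) in auto)

text \<open>Listing each parameter with its multiplicity reduces nested iteration to induction over
  one list.\<close>

lemma foldr_funpow_eq_foldr_concat:
  "foldr (\<lambda>i. f (a i) ^^ n i) xs y = foldr f (concat (map (\<lambda>i. replicate (n i) (a i)) xs)) y"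
proof -
  have "foldr f (replicate k c) z = (f c ^^ k) z" for k c z by (induction k) auto
  then show ?thesis by (induction xs) auto
qed

text \<open>The nonstationary term survives only if no operator is applied.\<close>

lemma (in tame_process) tame_process_foldr:
  assumes "\<forall>a\<in>set ls. 0 < a"
  shows "tame_process M (\<lambda>t w. foldr exp_diff ls (\<lambda>s. Y s w) t)
    (if ls = [] then \<alpha> else (\<lambda>_. 0)) (foldr cov_op ls g)"
  using assms
proof (induction ls)
  case Nil
  show ?case using tame_process_axioms by simp
next
  case (Cons a ls)
  then interpret X: tame_process M "\<lambda>t w. foldr exp_diff ls (\<lambda>s. Y s w) t"
    "if ls = [] then \<alpha> else (\<lambda>_. 0)" "foldr cov_op ls g" by simp
  show ?case using X.tame_process_Z[of a] Cons.prems by simp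
qed

text \<open>The last two list entries act first and create the decay; all earlier entries preserve
  it.\<close>

lemma quad_decay_foldr_cov_op:
  assumes p: "1 \<le> p" "p \<le> 2" and "\<forall>a\<in>set ls. 0 < a" "2 \<le> length ls"
  shows "quad_decay (foldr cov_op ls (\<lambda>x. c * \<bar>x\<bar> powr p))"
  using assms(3,4)
proof (induction ls)
  case (Cons a ls)
  show ?case
  proof (cases "2 \<le> length ls")
    case True
    then show ?thesis using Cons quad_decay_cov_op[of a] by simp
  next
    case False
    then have "length ls = Suc 0" using Cons.prems by simp
    then obtain b where "ls = [b]" by (auto simp: length_Suc_conv)
    then show ?thesis using Cons.prems quad_decay_cov_op_cov_op[OF p, of a b c] by simp
  qed
qed simp

section \<open>Passage to the completion\<close>

text \<open>Preimages under \<open>f\<close> and \<open>g\<close> differ inside a null set of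
  \<open>M\<close>, whose subsets are all measurable in the completion.\<close>

lemma completion_measurable_AE_eq:
  fixes f g :: "'a \<Rightarrow> real"
  assumes f: "f \<in> borel_measurable M" and eq: "AE w in M. g w = f w"
  shows "g \<in> borel_measurable (completion M)"
proof (rule measurableI)
  fix A :: "real set" assume A: "A \<in> sets borel"
  have fA: "f -` A \<inter> space M \<in> sets (completion M)" using measurable_sets[OF f A] by simp
  have "AE w in completion M. w \<in> f -` A \<inter> space M \<longleftrightarrow> w \<in> g -` A \<inter> space M"
    using AE_completion[OF eq] by eventually_elim auto
  from completion.in_sets_AE[OF this fA] show "g -` A \<inter> space (completion M) \<in> sets (completion M)"
    by simp
qed simp

lemma completion_integral_AE_eq:
  fixes f g :: "'a \<Rightarrow> real"
  assumes f: "f \<in> borel_measurable M" and eq: "AE w in M. g w = f w"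
  shows "(\<integral>w. g w \<partial>completion M) = (\<integral>w. f w \<partial>M)"
    and "integrable (completion M) g \<longleftrightarrow> integrable M f"
proof -
  have "(\<integral>w. g w \<partial>completion M) = (\<integral>w. f w \<partial>completion M)"
    by (intro integral_cong_AE completion_measurable_AE_eq[OF assms] measurable_completion f AE_completion eq)
  then show "(\<integral>w. g w \<partial>completion M) = (\<integral>w. f w \<partial>M)" by (simp add: integral_completion f)
  have "integrable (completion M) g \<longleftrightarrow> integrable (completion M) f"
    by (intro integrable_cong_AE completion_measurable_AE_eq[OF assms] measurable_completion f AE_completion eq)
  then show "integrable (completion M) g \<longleftrightarrow> integrable M f" by (simp add: integrable_completion f)
qed

lemma (in tame_process) short_memory_completion:
  assumes \<alpha>: "\<alpha> = (\<lambda>_. 0)" and g: "quad_decay g"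
    and eq: "AE w in M. \<forall>t. X t w = Y t w"
  shows "short_memory (completion M) X"
proof -
  have eq1: "AE w in M. X t w = Y t w" for t using eq by eventually_elim simp
  have eq2: "AE w in M. X s w * X t w = Y s w * Y t w" for s t using eq by eventually_elim simp
  have sq: "AE w in M. (X t w)\<^sup>2 = (Y t w)\<^sup>2" for t using eq by eventually_elim simp
  have cov': "(\<integral>w. X s w * X t w \<partial>completion M) = g (s - t)" for s t
    using completion_integral_AE_eq(1)[OF _ eq2] cov[of s t] by (simp add: \<alpha>)
  have "X t \<in> borel_measurable (completion M)" for t
    by (rule completion_measurable_AE_eq[OF meas eq1])
  moreover have "integrable (completion M) (\<lambda>w. (X t w)\<^sup>2)" for t
    using completion_integral_AE_eq(2)[OF _ sq] sq_int by simp
  moreover have "(\<integral>w. X t w \<partial>completion M) = 0" for t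
    using completion_integral_AE_eq(1)[OF meas eq1] mean by simp
  ultimately show ?thesis
    using quad_decay_summable_on_int[OF g]
    unfolding short_memory_def stationary_centered_def by (simp add: cov')
qed

theorem mainTheorem1:
  fixes M :: "'a measure" and B :: "real \<Rightarrow> 'a \<Rightarrow> real"
    and H \<sigma> :: real and q :: nat and l :: "nat \<Rightarrow> real" and p :: "nat \<Rightarrow> nat"
  assumes "prob_space M"
    and "1/2 < H" and "H \<le> 1" and "\<sigma> > 0"
    and "fractional_brownian_motion M H B"
    and "q \<ge> 1"
    and "\<forall>i\<in>{1..q}. l i > 0" and "inj_on l {1..q}"
    and "\<forall>i\<in>{1..q}. p i \<ge> 1"
    and "(\<Sum>i=1..q. p i) \<ge> 2"
  shows "short_memory (completion M) (\<lambda>t w. OU_prod q l p (\<lambda>s. \<sigma> * B s w) t)"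
proof -
  interpret prob_space M by fact
  note fbm = fractional_brownian_motionD[OF \<open>prob_space M\<close> \<open>fractional_brownian_motion M H B\<close>]
  have H: "1 < 2 * H" "2 * H \<le> 2" using assms(2,3) by auto
  define ls where "ls = concat (map (\<lambda>i. replicate (p i) (l i)) [1..<Suc q])"
  have ls_pos: "\<forall>a\<in>set ls. 0 < a" using assms(7) by (auto simp: ls_def)
  have "length ls = (\<Sum>i\<leftarrow>[1..<Suc q]. p i)" by (simp add: ls_def length_concat o_def)
  also have "\<dots> = (\<Sum>i=1..q. p i)"
    by (simp add: interv_sum_list_conv_sum_set_nat atLeastLessThanSuc_atLeastAtMost del: upt_Suc)
  finally have ls_len: "2 \<le> length ls" using assms(10) by simp
  have OU: "OU_prod q l p y = foldr OU_op ls y" for y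
    unfolding OU_prod_def ls_def by (rule foldr_funpow_eq_foldr_concat)
  have "AE w in M. continuous_on UNIV (\<lambda>t. B t w)"
    using \<open>fractional_brownian_motion M H B\<close> unfolding fractional_brownian_motion_def by blast
  then have "AE w in M. tame (\<lambda>t. B t w)"
    using fbm H by (intro AE_tame[where K = 1 and p = "2 * H"]) auto
  \<comment> \<open>The set of bad paths need not be measurable, so a measurable null set covering
    it is taken.\<close>
  then obtain N where N: "{w \<in> space M. \<not> tame (\<lambda>t. B t w)} \<subseteq> N" "N \<in> null_sets M"
    by (auto elim!: AE_E)
  then have [measurable]: "N \<in> sets M" by auto
  note [measurable] = fbm(1)
  \<comment> \<open>Zeroing the paths on \<open>N\<close> makes every path tame, as the locale
    demands, and keeps \<open>Y t\<close> measurable for \<open>M\<close> itself.\<close>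
  define Y where "Y t w = (if w \<in> space M - N then \<sigma> * B t w else 0)" for t w
  have AE_N: "AE w in M. w \<in> space M - N" using AE_not_in[OF N(2)] by (auto elim!: eventually_mono)
  then have AE_Y: "AE w in M. \<forall>t. Y t w = \<sigma> * B t w" by eventually_elim (simp add: Y_def)
  have Y_meas: "Y t \<in> borel_measurable M" for t unfolding Y_def by measurable
  have Y_cov: "(\<integral>w. Y s w * Y t w \<partial>M) = \<sigma>\<^sup>2 * (\<integral>w. B s w * B t w \<partial>M)" for s t
  proof -
    have "(\<integral>w. Y s w * Y t w \<partial>M) = (\<integral>w. \<sigma>\<^sup>2 * (B s w * B t w) \<partial>M)"
      using AE_Y Y_meas by (intro integral_cong_AE) (auto elim!: eventually_mono simp: power2_eq_square)
    then show ?thesis by simp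
  qed
  \<comment> \<open>Expanding the covariance of \<open>\<sigma> * B\<close> puts the one-time terms
    into \<open>\<alpha>\<close> and the term in \<open>s - t\<close> into \<open>g\<close>.\<close>
  interpret Y: tame_process M Y "\<lambda>t. \<sigma>\<^sup>2 / 2 * \<bar>t\<bar> powr (2 * H)" "\<lambda>t. - \<sigma>\<^sup>2 / 2 * \<bar>t\<bar> powr (2 * H)"
  proof
    show "tame (\<lambda>t. Y t w)" for w
    proof (cases "w \<in> space M - N")
      case True
      then have "tame (\<lambda>t. B t w)" using N(1) by blast
      then show ?thesis using True unfolding Y_def by (simp only: if_True tame_cmult)
    next
      case False
      then show ?thesis unfolding Y_def by (simp only: if_False tame_zero)
    qed
    show "Y t \<in> borel_measurable M" for t by (rule Y_meas)
    have "AE w in M. (Y t w)\<^sup>2 = \<sigma>\<^sup>2 * (B t w)\<^sup>2" for t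
      using AE_Y by eventually_elim (simp add: power_mult_distrib)
    then have "integrable M (\<lambda>w. (Y t w)\<^sup>2) \<longleftrightarrow> integrable M (\<lambda>w. \<sigma>\<^sup>2 * (B t w)\<^sup>2)" for t
      using Y_meas by (intro integrable_cong_AE) auto
    then show "integrable M (\<lambda>w. (Y t w)\<^sup>2)" for t using fbm(2) by simp
    have "(\<integral>w. (Y t w)\<^sup>2 \<partial>M) \<le> \<sigma>\<^sup>2 * (1 + \<bar>t\<bar>) ^ 2" for t
      using Y_cov[of t t] fbm(3)[of t] mult_left_mono[OF abs_powr_le_square[of "2 * H" t], of "\<sigma>\<^sup>2"] H
      by (simp add: power2_eq_square)
    then show "\<exists>D. \<forall>t. (\<integral>w. (Y t w)\<^sup>2 \<partial>M) \<le> D * (1 + \<bar>t\<bar>) ^ 2" by blast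
    have "(\<integral>w. Y t w \<partial>M) = (\<integral>w. \<sigma> * B t w \<partial>M)" for t
      using AE_Y Y_meas by (intro integral_cong_AE) (auto elim!: eventually_mono)
    then show "(\<integral>w. Y t w \<partial>M) = 0" for t
      using \<open>fractional_brownian_motion M H B\<close> by (simp add: fractional_brownian_motion_def)
    have covB: "(\<integral>w. B s w * B t w \<partial>M) =
        (1/2) * (\<bar>s\<bar> powr (2 * H) + \<bar>t\<bar> powr (2 * H) - \<bar>s - t\<bar> powr (2 * H))" for s t
      using \<open>fractional_brownian_motion M H B\<close> by (simp add: fractional_brownian_motion_def)
    show "(\<integral>w. Y s w * Y t w \<partial>M) = \<sigma>\<^sup>2 / 2 * \<bar>s\<bar> powr (2 * H)
        + \<sigma>\<^sup>2 / 2 * \<bar>t\<bar> powr (2 * H) + - \<sigma>\<^sup>2 / 2 * \<bar>s - t\<bar> powr (2 * H)" for s t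
      unfolding Y_cov covB by (simp add: field_simps)
  qed
  interpret X: tame_process M "\<lambda>t w. foldr exp_diff ls (\<lambda>s. Y s w) t"
    "if ls = [] then \<lambda>t. \<sigma>\<^sup>2 / 2 * \<bar>t\<bar> powr (2 * H) else (\<lambda>_. 0)"
    "foldr cov_op ls (\<lambda>t. - \<sigma>\<^sup>2 / 2 * \<bar>t\<bar> powr (2 * H))"
    by (rule Y.tame_process_foldr[OF ls_pos])
  show ?thesis
  proof (rule X.short_memory_completion)
    show "(if ls = [] then \<lambda>t. \<sigma>\<^sup>2 / 2 * \<bar>t\<bar> powr (2 * H) else (\<lambda>_. 0)) = (\<lambda>_. 0)"
      using ls_len by auto
    show "quad_decay (foldr cov_op ls (\<lambda>t. - \<sigma>\<^sup>2 / 2 * \<bar>t\<bar> powr (2 * H)))"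
      using H ls_pos ls_len by (intro quad_decay_foldr_cov_op) auto
    show "AE w in M. \<forall>t. OU_prod q l p (\<lambda>s. \<sigma> * B s w) t = foldr exp_diff ls (\<lambda>s. Y s w) t"
      using AE_Y
    proof eventually_elim
      case (elim w)
      then have "(\<lambda>s. \<sigma> * B s w) = (\<lambda>s. Y s w)" by auto
      then show ?case by (simp add: OU foldr_OU_op_eq_exp_diff(1)[OF Y.tame ls_pos])
    qed
  qed
qed

end
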